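(* Let $\phi:\mathbb{R}^n\to\mathbb{R}$ be convex and $1/\gamma$ smooth, let $g:\mathbb{R}^m\to\mathbb{R}\cup\{+\infty\}$ be convex and $\lambda$ strongly convex (with $\gamma,\lambda>0$), and let $A\in\mathbb{R}^{p\times n}$, $B\in\mathbb{R}^{p\times m}$, $c\in\mathbb{R}^p$, $\rho>0$. Let $G\in\mathbb{R}^{m\times m}$ and $H\in\mathbb{R}^{n\times n}$ be symmetric positive semi-definite, and assume that $H=A^\top\tilde H A$ for a symmetric positive semi-definite matrix $\tilde H\in\mathbb{R}^{p\times p}$. Let $\sigma_{\max}(H)$ and $\sigma_{\max}(\tilde H)$ be the largest eigenvalues of $H$ and $\tilde H$, let $\sigma_{\min}(A)$ be the smallest eigenvalue of $(AA^\top)^{1/2}$, and let $\sigma_{\max}(B)$, $\sigma_{\max}(G)$ be the largest singular values of $B$ and $G$. Let $s\in[0,1)$ and $\theta>0$ satisfy $$\theta\le\min\left(\frac{\gamma\rho\,\sigma_{\min}(A)^2}{\gamma\sigma_{\max}(H)+1},\ \frac{s\rho}{\sigma_{\max}(\tilde H)},\ \frac{(1-s)\lambda}{(\rho+\sigma_{\max}(\tilde H))\sigma_{\max}(B)^2+(1-s)\rho\,\sigma_{\max}(G)}\right).$$ Let $(w_*,v_*,\alpha_* )$ be an optimal solution of $\min_{w,v}[\phi(w)+g(v)]$ subject to $Aw-Bv=c$, in the sense that $$Aw_*-Bv_*-c=0,\quad A^\top\alpha_*=-\nabla\phi(w_* ),\quad w_*=\nabla\phi^*(-A^\top\alpha_*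 ),\quad B^\top\alpha_*=\nabla g(v_* ).$$ Let $(v^t,w^t,\alpha^t)_{t\ge 1}$ be generated from arbitrary $w^0\in\mathbb{R}^n$, $v^0\in\mathbb{R}^m$, $\alpha^0\in\mathbb{R}^p$ by the preconditioned standard ADMM algorithm (defined in the context), and let $\tilde\alpha^t=\alpha^t+\tilde H A(w^t-w^{t-1})$ for $t\ge 1$. Then for every $T\ge1$, $$\sum_{t=1}^T(1+\theta)^{t-T}\Big[\max\big(D_\phi(w_*,w^t),\,D_{\phi^*}(-A^\top\alpha_*,-A^\top\tilde\alpha^t)\big)+D_g(v_*,v^t)\Big]$$ $$+\frac{\rho}{2}\|A(w^T-w_* )\|_2^2+\frac12\|A(w^T-w_* )\|_{\tilde H}^2+\frac{1+\theta}{2\rho}\|\alpha^T-\alpha_*\|_2^2+\frac{\rho(1+\theta)}{2}\|v^T-v_*\|_G^2$$ $$\le\frac{(1+\theta)^{-T}}{2}\left[\rho\|A(w^0-w_* )\|_2^2+\|A(w^0-w_* )\|_{\tilde H}^2+\frac{1+\theta}{\rho}\|\alpha^0-\alpha_*\|_2^2+\rho(1+\theta)\|v^0-v_*\|_G^2\right].$$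
   Context: For a symmetric positive semi-definite matrix $M$, $\|x\|_M^2=x^\top Mx$. Preconditioned standard ADMM: given $w^0,v^0,\alpha^0$, for $t=1,2,\ldots$, $$v^t=\arg\min_v\Big[g(v)-(\alpha^{t-1})^\top Bv+\tfrac{\rho}{2}\|Aw^{t-1}-Bv-c\|_2^2+\tfrac{\rho}{2}\|v-v^{t-1}\|_G^2\Big],$$ $$w^t=\arg\min_w\Big[\phi(w)+(\alpha^{t-1})^\top Aw+\tfrac{\rho}{2}\|Aw-Bv^t-c\|_2^2+\tfrac12\|w-w^{t-1}\|_H^2\Big],$$ $$\alpha^t=\alpha^{t-1}+\rho(Aw^t-Bv^t-c).$$ The minimizers are assumed to exist (any minimizer may be taken). For a convex function $h$, $h^*(\beta)=\sup_u[\beta^\top u-h(u)]$ is the convex conjugate, and $D_h(u',u)=h(u)-h(u')-\nabla h(u')^\top(u-u')$ is the Bregman divergence. "$\phi$ is $1/\gamma$ smooth" means $\phi$ is differentiable with $D_\phi(w',w)\le\frac{1}{2\gamma}\|w'-w\|_2^2$ for all $w,w'$. "$g$ is $\lambda$ strongly convex" means $D_g(v',v)\ge\frac{\lambda}{2}\|v'-v\|_2^2$ for all $v,v'$; $g$ may be nondifferentiable or take the value $+\infty$ (but is not identically $+\infty$), in which case $\nabla g(v')$ stands for any subgradient at $v'$. If $g$ or $\phi^*$ is not differentiable, the optimality relations are read as $B^\top\alpha_*\in\partial g(v_* )$ and $w_*\in\partial\phi^*(-A^\top\alpha_* )$, and the subgradients used in $D_g(v_*,\cdot)$ and $D_{\phi^*}(-A^\top\alpha_*,\cdot)$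 are $B^\top\alpha_*$ and $w_*$ respectively. A fraction with zero denominator in the bound on $\theta$ is read as $+\infty$ (e.g. the second term when $\tilde H=0$). *)

theory Defs
  imports "HOL-Analysis.Analysis"
begin

section \<open>Matrices\<close>

definition sym_psd :: "real^'n^'n \<Rightarrow> bool" where
  "sym_psd M \<longleftrightarrow> transpose M = M \<and> (\<forall>x. 0 \<le> x \<bullet> (M *v x))"

definition sqnorm :: "real^'n^'n \<Rightarrow> real^'n \<Rightarrow> real" where
  "sqnorm M x = x \<bullet> (M *v x)"

definition eigenvalue :: "real^'n^'n \<Rightarrow> real \<Rightarrow> bool" where
  "eigenvalue M l \<longleftrightarrow> (\<exists>x. x \<noteq> 0 \<and> M *v x = l *\<^sub>R x)"

definition largest_eigenvalue :: "real^'n^'n \<Rightarrow> real" where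
  "largest_eigenvalue M = (GREATEST l. eigenvalue M l)"

definition smallest_eigenvalue :: "real^'n^'n \<Rightarrow> real" where
  "smallest_eigenvalue M = (LEAST l. eigenvalue M l)"

definition psd_sqrt :: "real^'n^'n \<Rightarrow> real^'n^'n" where
  "psd_sqrt M = (THE S. sym_psd S \<and> S ** S = M)"

definition singular_value :: "real^'m^'p \<Rightarrow> real \<Rightarrow> bool" where
  "singular_value M s \<longleftrightarrow> 0 \<le> s \<and> eigenvalue (transpose M ** M) (s\<^sup>2)"

definition largest_singular_value :: "real^'m^'p \<Rightarrow> real" where
  "largest_singular_value M = (GREATEST s. singular_value M s)"

text \<open>For a wide or square matrix this is its smallest singular value; it is \<open>0\<close> when the
  matrix has more rows than columns.\<close>

definition sigma_min :: "real^'n^'p \<Rightarrow> real" where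
  "sigma_min A = smallest_eigenvalue (psd_sqrt (A ** transpose A))"


section \<open>Convex analysis with extended-real-valued functions\<close>

definition gradient :: "('a::real_inner \<Rightarrow> real) \<Rightarrow> 'a \<Rightarrow> 'a" where
  "gradient f x = (THE D. GDERIV f x :> D)"

text \<open>Since \<open>0 * \<infinity> = 0\<close> in \<^typ>\<open>ereal\<close>, the inequality is harmless for \<open>t = 0\<close> and \<open>t = 1\<close>.
  It is meant for functions that do not take the value \<open>-\<infinity>\<close>.\<close>

definition ereal_convex :: "('a::real_vector \<Rightarrow> ereal) \<Rightarrow> bool" where
  "ereal_convex h \<longleftrightarrow> (\<forall>x y t. 0 \<le> t \<and> t \<le> 1 \<longrightarrow>
     h ((1 - t) *\<^sub>R x + t *\<^sub>R y) \<le> ereal (1 - t) * h x + ereal t * h y)"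

definition subgradient :: "('a::real_inner \<Rightarrow> ereal) \<Rightarrow> 'a \<Rightarrow> 'a \<Rightarrow> bool" where
  "subgradient h x \<xi> \<longleftrightarrow> \<bar>h x\<bar> \<noteq> \<infinity> \<and> (\<forall>y. h x + ereal (\<xi> \<bullet> (y - x)) \<le> h y)"

definition convex_conjugate :: "('a::real_inner \<Rightarrow> ereal) \<Rightarrow> 'a \<Rightarrow> ereal" where
  "convex_conjugate h \<beta> = (SUP u. ereal (\<beta> \<bullet> u) - h u)"

text \<open>The divergence \<open>D_h(u', u)\<close>, where \<open>\<xi>\<close> is the gradient, or the chosen subgradient,
  of \<open>h\<close> at the first argument \<open>u'\<close>.\<close>

definition bregman :: "('a::real_inner \<Rightarrow> ereal) \<Rightarrow> 'a \<Rightarrow> 'a \<Rightarrow> 'a \<Rightarrow> ereal" where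
  "bregman h \<xi> u' u = h u - h u' - ereal (\<xi> \<bullet> (u - u'))"

definition smooth_wrt :: "real \<Rightarrow> ('a::real_inner \<Rightarrow> real) \<Rightarrow> bool" where
  "smooth_wrt L f \<longleftrightarrow> (\<forall>x. f differentiable (at x)) \<and>
     (\<forall>w w'. bregman (\<lambda>u. ereal (f u)) (gradient f w') w' w \<le> ereal (L / 2 * (norm (w' - w))\<^sup>2))"

definition strongly_convex :: "real \<Rightarrow> ('a::real_inner \<Rightarrow> ereal) \<Rightarrow> bool" where
  "strongly_convex \<mu> h \<longleftrightarrow>
     (\<forall>v v' \<xi>. subgradient h v' \<xi> \<longrightarrow> ereal (\<mu> / 2 * (norm (v' - v))\<^sup>2) \<le> bregman h \<xi> v' v)"


section \<open>Preconditioned standard ADMM\<close>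

text \<open>The optimality (KKT) relations of \<open>min \<phi>(w) + g(v)\<close> subject to \<open>A w - B v = c\<close>.\<close>

definition optimal_triple ::
  "(real^'n \<Rightarrow> real) \<Rightarrow> (real^'m \<Rightarrow> ereal) \<Rightarrow> real^'n^'p \<Rightarrow> real^'m^'p \<Rightarrow> real^'p \<Rightarrow>
   real^'n \<Rightarrow> real^'m \<Rightarrow> real^'p \<Rightarrow> bool" where
  "optimal_triple \<phi> g A B c w v \<alpha> \<longleftrightarrow>
     A *v w - B *v v - c = 0 \<and>
     transpose A *v \<alpha> = - gradient \<phi> w \<and>
     subgradient (convex_conjugate (\<lambda>u. ereal (\<phi> u))) (- (transpose A *v \<alpha>)) w \<and>
     subgradient g v (transpose B *v \<alpha>)"

definition padmm ::
  "(real^'n \<Rightarrow> real) \<Rightarrow> (real^'m \<Rightarrow> ereal) \<Rightarrow> real^'n^'p \<Rightarrow> real^'m^'p \<Rightarrow> real^'p \<Rightarrow> real \<Rightarrow>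
   real^'m^'m \<Rightarrow> real^'n^'n \<Rightarrow>
   (nat \<Rightarrow> real^'n) \<Rightarrow> (nat \<Rightarrow> real^'m) \<Rightarrow> (nat \<Rightarrow> real^'p) \<Rightarrow> bool" where
  "padmm \<phi> g A B c \<rho> G H w v \<alpha> \<longleftrightarrow> (\<forall>t\<ge>1.
     is_arg_min
       (\<lambda>x. g x + ereal (- (\<alpha> (t - 1) \<bullet> (B *v x))
              + \<rho> / 2 * (norm (A *v w (t - 1) - B *v x - c))\<^sup>2
              + \<rho> / 2 * sqnorm G (x - v (t - 1))))
       (\<lambda>_. True) (v t) \<and>
     is_arg_min
       (\<lambda>x. \<phi> x + \<alpha> (t - 1) \<bullet> (A *v x)
              + \<rho> / 2 * (norm (A *v x - B *v v t - c))\<^sup>2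
              + 1 / 2 * sqnorm H (x - w (t - 1)))
       (\<lambda>_. True) (w t) \<and>
     \<alpha> t = \<alpha> (t - 1) + \<rho> *\<^sub>R (A *v w t - B *v v t - c))"

text \<open>A fraction that is \<open>+\<infinity>\<close> whenever its denominator vanishes.  Division on \<^typ>\<open>ereal\<close>
  does not serve, as there \<open>0 / 0 = 0\<close>.\<close>

definition ext_frac :: "real \<Rightarrow> real \<Rightarrow> ereal" where
  "ext_frac a b = (if b = 0 then \<infinity> else ereal (a / b))"

end

theory Submission
  imports Defs
begin

text \<open>
  The optimality conditions of the two subproblems are \<open>\<nabla>\<phi>(w\<^sup>t) = - A\<^sup>T \<alpha>t\<^sup>t\<close> and
  \<open>B\<^sup>T(\<alpha>\<^sup>t\<^sup>-\<^sup>1 + \<rho>(A w\<^sup>t\<^sup>-\<^sup>1 - B v\<^sup>t - c)) - \<rho> G(v\<^sup>t - v\<^sup>t\<^sup>-\<^sup>1) \<in> \<partial>g(v\<^sup>t)\<close>. Both \<open>\<phi>\<close>-divergences equal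
  \<open>\<langle>\<nabla>\<phi>(w\<^sup>t) - \<nabla>\<phi>(w\<^sub>s), w\<^sup>t - w\<^sub>s\<rangle>\<close> minus the opposite divergence, the conjugate one because
  \<open>D\<close> of \<open>\<phi>\<close>-conjugate at gradients is \<open>D\<close> of \<open>\<phi>\<close> with swapped arguments; the subtracted divergence
  is at least \<open>\<gamma>/2\<close> times the squared gradient difference. Likewise strong convexity
  leaves a spare \<open>\<mu>/2\<close> times the squared distance of \<open>v\<^sup>t\<close> to \<open>v\<^sub>s\<close>. Polarization turns the inner products
  into a telescoping energy difference minus nonnegative residuals, and the three bounds on \<open>\<theta>\<close>
  say exactly that residuals and spare terms absorb the extra factor \<open>1 + \<theta>\<close>.
\<close>

text \<open>For small positive t the linear term dominates. When \<open>b\<close> is positive, the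
  witness \<open>a / b\<close> minimizes the quadratic, with value \<open>- a\<^sup>2 / b\<close>.
  This serves as the first-order condition in the maximization below.\<close>

lemma nonneg_quadratic_imp_zero:
  fixes a b :: real
  assumes "a \<ge> 0" and "\<And>t. 0 \<le> t\<^sup>2 * b - 2 * t * a"
  shows "a = 0"
proof (rule ccontr)
  assume "a \<noteq> 0"
  with assms(1) have a: "a > 0" by simp
  show False
  proof (cases "b > 0")
    case True
    from assms(2)[of "a / b"] True have "a\<^sup>2 \<le> 0"
      by (simp add: field_simps power2_eq_square)
    with a show False by simp
  next
    case False
    with assms(2)[of 1] a show False by simp
  qed
qed

section \<open>The spectral theorem for self-adjoint maps\<close>

text \<open>The form \<open>x \<bullet> f x\<close> attains its maximum on the compact unit sphere
  of \<open>S\<close>. Perturbing the maximizer inside \<open>S\<close> shows that it is an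
  eigenvector; homogeneity extends the bound to all of \<open>S\<close>.\<close>

lemma rayleigh_maximum:
  fixes f :: "'a::euclidean_space \<Rightarrow> 'a"
  assumes lin: "linear f" and sa: "\<And>x y. f x \<bullet> y = x \<bullet> f y"
    and S: "subspace S" "f ` S \<subseteq> S" "S \<noteq> {0}"
  obtains x l where "x \<in> S" "norm x = 1" "f x = l *\<^sub>R x" "\<And>y. y \<in> S \<Longrightarrow> y \<bullet> f y \<le> l * (y \<bullet> y)"
proof -
  interpret f: linear f by fact
  let ?K = "S \<inter> sphere 0 1"
  have "compact ?K" by (intro closed_Int_compact closed_subspace S) simp
  moreover have "?K \<noteq> {}"
  proof -
    from S(1,3) obtain z where z: "z \<in> S" "z \<noteq> 0" using subspace_0 by blast
    then have "z /\<^sub>R norm z \<in> ?K" by (simp add: S(1) subspace_scale)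
    then show ?thesis by blast
  qed
  moreover have "continuous_on ?K (\<lambda>x. x \<bullet> f x)"
    by (intro continuous_intros linear_continuous_on linear_conv_bounded_linear[THEN iffD1] lin)
  ultimately obtain x where x: "x \<in> ?K" and max: "\<And>y. y \<in> ?K \<Longrightarrow> y \<bullet> f y \<le> x \<bullet> f x"
    using continuous_attains_sup[of ?K "\<lambda>x. x \<bullet> f x"] by blast
  define l where "l = x \<bullet> f x"
  have xx: "x \<bullet> x = 1" using x by (simp add: dot_square_norm)
  have bound: "y \<bullet> f y \<le> l * (y \<bullet> y)" if "y \<in> S" for y
  proof (cases "y = 0")
    case False
    let ?z = "y /\<^sub>R norm y"
    have "?z \<bullet> f ?z \<le> l" unfolding l_def
      using that False by (intro max) (simp add: S(1) subspace_scale)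
    moreover have "?z \<bullet> f ?z = (y \<bullet> f y) / (y \<bullet> y)"
      by (simp add: f.scale dot_square_norm power2_eq_square divide_simps)
    ultimately have "(y \<bullet> f y) / (y \<bullet> y) \<le> l" by simp
    then show ?thesis using False by (simp add: pos_divide_le_eq)
  qed (simp add: f.zero)
  define r where "r = l *\<^sub>R x - f x"
  have rS: "r \<in> S" unfolding r_def using x S by (auto intro!: subspace_diff subspace_scale)
  \<comment> \<open>Test \<open>bound\<close> on \<open>x - t *\<^sub>R r\<close>, which stays in
    \<open>S\<close> by invariance. As \<open>r\<close> is orthogonal to \<open>x\<close> and
    \<open>x \<bullet> f r = - (r \<bullet> r)\<close>, the linear coefficient in t is
    \<open>- 2 * (r \<bullet> r)\<close>.\<close>
  have "r \<bullet> r = 0"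
  proof (rule nonneg_quadratic_imp_zero)
    fix t :: real
    have fx: "f x = l *\<^sub>R x - r" by (simp add: r_def)
    have xr: "x \<bullet> r = 0" by (simp add: r_def inner_diff_right xx) (simp add: l_def)
    have xfr: "x \<bullet> f r = - (r \<bullet> r)"
      using sa[of x r] by (simp add: fx inner_diff_left xr)
    have "x - t *\<^sub>R r \<in> S" using x rS S by (auto intro!: subspace_diff subspace_scale)
    from bound[OF this]
    show "0 \<le> t\<^sup>2 * (l * (r \<bullet> r) - r \<bullet> f r) - 2 * t * (r \<bullet> r)"
      by (simp add: f.diff f.scale fx inner_diff_left inner_diff_right xx xr xfr inner_commute[of r x]
          algebra_simps power2_eq_square)
  qed simp
  then have "f x = l *\<^sub>R x" by (simp add: r_def)
  with x bound show thesis by (intro that) auto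
qed

text \<open>Split off one Rayleigh eigenvector and recurse on its orthogonal complement in
  \<open>S\<close>, which is invariant because \<open>f\<close> is self-adjoint. The formulation for
  invariant subspaces is what the induction on dimension needs.\<close>

theorem spectral_theorem:
  fixes f :: "'a::euclidean_space \<Rightarrow> 'a"
  assumes "linear f" and sa: "\<And>x y. f x \<bullet> y = x \<bullet> f y"
    and "subspace S" "f ` S \<subseteq> S"
  shows "\<exists>E\<subseteq>S. pairwise orthogonal E \<and> (\<forall>e\<in>E. norm e = 1 \<and> (\<exists>l. f e = l *\<^sub>R e)) \<and> span E = S"
  using assms(3,4)
proof (induction "dim S" arbitrary: S rule: less_induct)
  case less
  show ?case
  proof (cases "S = {0}")
    case True
    then show ?thesis by (intro exI[of _ "{}"]) simp
  next
    case False
    obtain x l where x: "x \<in> S" "norm x = 1" "f x = l *\<^sub>R x"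
      using rayleigh_maximum[OF assms(1) sa less.prems False] by metis
    have xx: "x \<bullet> x = 1" using x by (simp add: dot_square_norm)
    define S' where "S' = S \<inter> {y. x \<bullet> y = 0}"
    have S': "subspace S'"
      unfolding S'_def by (intro subspace_inter less.prems subspace_hyperplane)
    have "f ` S' \<subseteq> S'"
    proof
      fix z assume "z \<in> f ` S'"
      then obtain y where y: "z = f y" "y \<in> S" "x \<bullet> y = 0" by (auto simp: S'_def)
      have "x \<bullet> f y = 0" using sa[of x y] x y by simp
      then show "z \<in> S'" using y less.prems by (auto simp: S'_def)
    qed
    moreover have "dim S' < dim S"
    proof (rule dim_psubset)
      have "x \<notin> S'" using xx by (simp add: S'_def)
      moreover have "S' \<subseteq> S" by (auto simp: S'_def)
      ultimately have "S' \<subset> S" using x(1) by blast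
      then show "span S' \<subset> span S" by (simp add: S' less.prems span_eq_iff[THEN iffD2])
    qed
    ultimately obtain E where E: "E \<subseteq> S'" "pairwise orthogonal E"
      "\<forall>e\<in>E. norm e = 1 \<and> (\<exists>l. f e = l *\<^sub>R e)" "span E = S'"
      using less.hyps[OF _ S'] by blast
    have "S \<subseteq> span (insert x E)"
    proof
      fix y assume y: "y \<in> S"
      have "y - (x \<bullet> y) *\<^sub>R x \<in> S'"
        using x y less.prems by (auto simp: S'_def inner_diff_right xx intro!: subspace_diff subspace_scale)
      then show "y \<in> span (insert x E)" by (auto simp: span_insert E(4))
    qed
    moreover have "span (insert x E) \<subseteq> S"
      using x E(1) less.prems by (intro span_minimal) (auto simp: S'_def)
    moreover have "pairwise orthogonal (insert x E)"
      using E(1,2) by (auto simp: pairwise_insert orthogonal_def S'_def inner_commute)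
    ultimately show ?thesis using x E by (intro exI[of _ "insert x E"]) (auto simp: S'_def)
  qed
qed

section \<open>Eigenvalue and singular value bounds\<close>

lemma transpose_matrix_dot:
  fixes M :: "real^'n^'m"
  shows "(transpose M *v x) \<bullet> y = x \<bullet> (M *v y)"
  by (simp add: dot_lmul_matrix)

lemma symmetric_dot:
  fixes M :: "real^'n^'n"
  assumes "transpose M = M"
  shows "(M *v x) \<bullet> y = x \<bullet> (M *v y)"
  using transpose_matrix_dot[of M x y] assms by simp

lemma symmetric_matrixI:
  fixes M :: "real^'n^'n"
  assumes "\<And>x y. (M *v x) \<bullet> y = x \<bullet> (M *v y)"
  shows "transpose M = M"
proof -
  have "(transpose M *v x - M *v x) \<bullet> y = 0" for x y
    by (simp add: inner_diff_left transpose_matrix_dot assms del: transpose_matrix_vector)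
  then have "transpose M *v x = M *v x" for x by (metis inner_eq_zero_iff eq_iff_diff_eq_0)
  then show ?thesis by (simp add: matrix_eq del: transpose_matrix_vector)
qed

text \<open>The Rayleigh maximum over the whole space is an eigenvalue and dominates every other
  one, so the \<open>GREATEST\<close> in the definition exists and equals it.\<close>

lemma largest_eigenvalue_bound:
  fixes M :: "real^'n^'n"
  assumes "transpose M = M"
  shows "x \<bullet> (M *v x) \<le> largest_eigenvalue M * (x \<bullet> x)"
    and "eigenvalue M (largest_eigenvalue M)"
proof -
  have "(1::real^'n) \<noteq> 0" by simp
  then have "(UNIV::(real^'n) set) \<noteq> {0}" by blast
  then obtain u l where u: "norm u = 1" "M *v u = l *\<^sub>R u"
    and l: "\<And>y. y \<bullet> (M *v y) \<le> l * (y \<bullet> y)"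
    using rayleigh_maximum[of "(*v) M" UNIV] symmetric_dot[OF assms] by auto
  have ev: "eigenvalue M l" using u unfolding eigenvalue_def by (metis norm_zero zero_neq_one)
  moreover have "k \<le> l" if "eigenvalue M k" for k
  proof -
    from that obtain z where "z \<noteq> 0" "M *v z = k *\<^sub>R z" by (auto simp: eigenvalue_def)
    with l[of z] show ?thesis by simp
  qed
  ultimately have "largest_eigenvalue M = l"
    unfolding largest_eigenvalue_def by (rule Greatest_equality)
  with l ev show "x \<bullet> (M *v x) \<le> largest_eigenvalue M * (x \<bullet> x)"
    and "eigenvalue M (largest_eigenvalue M)" by auto
qed

lemma uminus_matrix_vector_mult:
  fixes M :: "real^'n^'m"
  shows "(- M) *v x = - (M *v x)"
  by (simp add: matrix_vector_mult_def vec_eq_iff sum_negf)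

lemma eigenvalue_uminus:
  fixes M :: "real^'n^'n"
  shows "eigenvalue (- M) l \<longleftrightarrow> eigenvalue M (- l)"
proof -
  have "- (M *v x) = l *\<^sub>R x \<longleftrightarrow> M *v x = - l *\<^sub>R x" for x
    by (subst minus_equation_iff) (rule eq_commute[THEN trans], simp)
  then show ?thesis by (simp only: eigenvalue_def uminus_matrix_vector_mult)
qed

lemma eigenvalue_nonneg:
  assumes "sym_psd M" "eigenvalue M l"
  shows "0 \<le> l"
proof -
  from assms(2) obtain x where x: "x \<noteq> 0" "M *v x = l *\<^sub>R x" by (auto simp: eigenvalue_def)
  have "0 \<le> x \<bullet> (M *v x)" using assms(1) by (simp add: sym_psd_def)
  with x have "0 \<le> l * (x \<bullet> x)" by simp
  moreover have "0 < x \<bullet> x" using x(1) by simp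
  ultimately show ?thesis using mult_neg_pos[of l "x \<bullet> x"] by linarith
qed

text \<open>Negation exchanges the two ends of the spectrum, so the previous lemma is applied to
  \<open>- M\<close>.\<close>

lemma smallest_eigenvalue_bound:
  fixes M :: "real^'n^'n"
  assumes "transpose M = M"
  shows "smallest_eigenvalue M * (x \<bullet> x) \<le> x \<bullet> (M *v x)"
    and "eigenvalue M (smallest_eigenvalue M)"
proof -
  have tr: "transpose (- M) = - M"
    by (rule symmetric_matrixI) (simp add: uminus_matrix_vector_mult symmetric_dot[OF assms])
  let ?l = "- largest_eigenvalue (- M)"
  have ev: "eigenvalue M ?l"
    using largest_eigenvalue_bound(2)[OF tr] by (simp add: eigenvalue_uminus)
  have bd: "?l * (x \<bullet> x) \<le> x \<bullet> (M *v x)" for x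
    using largest_eigenvalue_bound(1)[OF tr, of x] by (simp add: uminus_matrix_vector_mult)
  have "?l \<le> k" if "eigenvalue M k" for k
  proof -
    from that obtain z where z: "z \<noteq> 0" "M *v z = k *\<^sub>R z" by (auto simp: eigenvalue_def)
    have "?l * (z \<bullet> z) \<le> k * (z \<bullet> z)" using bd[of z] z(2) by simp
    then show ?thesis by (rule mult_right_le_imp_le) (simp add: z(1))
  qed
  with ev have "smallest_eigenvalue M = ?l"
    unfolding smallest_eigenvalue_def by (rule Least_equality)
  with bd ev show "smallest_eigenvalue M * (x \<bullet> x) \<le> x \<bullet> (M *v x)"
    and "eigenvalue M (smallest_eigenvalue M)" by auto
qed

lemma largest_eigenvalue_nonneg: "sym_psd M \<Longrightarrow> 0 \<le> largest_eigenvalue M"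
  using eigenvalue_nonneg largest_eigenvalue_bound(2) sym_psd_def by blast

lemma gram_dot:
  fixes M :: "real^'m^'p"
  shows "x \<bullet> ((transpose M ** M) *v x) = (norm (M *v x))\<^sup>2"
  using transpose_matrix_dot[of M "M *v x" x]
  by (simp only: matrix_vector_mul_assoc[symmetric] power2_norm_eq_inner inner_commute)

lemma gram_psd:
  fixes M :: "real^'m^'p"
  shows "sym_psd (transpose M ** M)"
  by (simp add: sym_psd_def gram_dot matrix_transpose_mul)

text \<open>The largest singular value is the square root of the largest eigenvalue of the Gram
  matrix, whose quadratic form is \<open>(norm (M *v x))\<^sup>2\<close>.\<close>

lemma largest_singular_value_bound:
  fixes M :: "real^'m^'p"
  shows "norm (M *v x) \<le> largest_singular_value M * norm x"
    and "0 \<le> largest_singular_value M"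
proof -
  let ?N = "transpose M ** M"
  let ?l = "largest_eigenvalue ?N"
  have N: "sym_psd ?N" "transpose ?N = ?N" using gram_psd[of M] by (auto simp: sym_psd_def)
  have l0: "0 \<le> ?l" using largest_eigenvalue_nonneg N by blast
  have "largest_singular_value M = sqrt ?l"
    unfolding largest_singular_value_def
  proof (rule Greatest_equality)
    show "singular_value M (sqrt ?l)"
      using l0 largest_eigenvalue_bound(2)[OF N(2)] by (simp add: singular_value_def)
  next
    fix k assume "singular_value M k"
    then obtain z where z: "z \<noteq> 0" "?N *v z = k\<^sup>2 *\<^sub>R z"
      by (auto simp: eigenvalue_def singular_value_def)
    have "k\<^sup>2 \<le> ?l" using largest_eigenvalue_bound(1)[OF N(2), of z] z by simp
    then show "k \<le> sqrt ?l" by (rule real_le_rsqrt)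
  qed
  moreover have "(norm (M *v x))\<^sup>2 \<le> ?l * (norm x)\<^sup>2"
    using largest_eigenvalue_bound(1)[OF N(2), of x] by (simp only: gram_dot power2_norm_eq_inner)
  then have "norm (M *v x) \<le> sqrt ?l * norm x"
    using real_le_rsqrt[of "norm (M *v x)" "?l * (norm x)\<^sup>2"] by (simp add: real_sqrt_mult)
  ultimately show "norm (M *v x) \<le> largest_singular_value M * norm x"
    "0 \<le> largest_singular_value M" using l0 by auto
qed

lemma psd_form_le_largest_singular_value:
  "sqnorm M x \<le> largest_singular_value M * (norm x)\<^sup>2"
proof -
  have "sqnorm M x \<le> norm x * norm (M *v x)" by (simp add: sqnorm_def norm_cauchy_schwarz)
  also have "\<dots> \<le> norm x * (largest_singular_value M * norm x)"
    by (intro mult_left_mono largest_singular_value_bound) simp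
  finally show ?thesis by (simp add: power2_eq_square mult_ac)
qed

text \<open>In terms of forms, the square of \<open>M\<close> is at most its largest eigenvalue
  times \<open>M\<close>. The form is nonnegative at \<open>x - t *\<^sub>R (M *v x)\<close>, and
  the reciprocal of that eigenvalue is the best t.\<close>

lemma psd_norm_image_le:
  assumes "sym_psd M"
  shows "(norm (M *v x))\<^sup>2 \<le> largest_eigenvalue M * sqnorm M x"
proof -
  let ?l = "largest_eigenvalue M" and ?r = "M *v x"
  have M: "transpose M = M" "\<And>x. 0 \<le> x \<bullet> (M *v x)" using assms by (auto simp: sym_psd_def)
  have q: "0 \<le> sqnorm M x - 2 * t * (?r \<bullet> ?r) + t\<^sup>2 * (?l * (?r \<bullet> ?r))" for t
  proof -
    have "0 \<le> (x - t *\<^sub>R ?r) \<bullet> (M *v (x - t *\<^sub>R ?r))" by (rule M)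
    also have "\<dots> = sqnorm M x - 2 * t * (?r \<bullet> ?r) + t\<^sup>2 * (?r \<bullet> (M *v ?r))"
    proof -
      have "x \<bullet> (M *v ?r) = ?r \<bullet> ?r" using symmetric_dot[OF M(1), of x ?r] by simp
      then show ?thesis
        by (simp add: sqnorm_def matrix_vector_mult_diff_distrib matrix_vector_mult_scaleR
            inner_diff_left inner_diff_right algebra_simps power2_eq_square inner_commute[of ?r x])
    qed
    also have "\<dots> \<le> sqnorm M x - 2 * t * (?r \<bullet> ?r) + t\<^sup>2 * (?l * (?r \<bullet> ?r))"
      by (intro add_mono mult_left_mono largest_eigenvalue_bound(1)[OF M(1)]) auto
    finally show ?thesis .
  qed
  have l: "0 \<le> ?l" by (rule largest_eigenvalue_nonneg[OF assms])
  show ?thesis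
  proof (cases "?l = 0")
    case True
    have s: "0 \<le> sqnorm M x" by (simp add: sqnorm_def M)
    have "?r \<bullet> ?r = 0"
    proof (rule ccontr)
      assume "?r \<bullet> ?r \<noteq> 0"
      then have "0 < ?r \<bullet> ?r" by simp
      \<comment> \<open>Without the quadratic term the lower bound is affine in t with negative
        slope; at this t its value is \<open>- sqnorm M x - 2\<close>.\<close>
      with q[of "(sqnorm M x + 1) / (?r \<bullet> ?r)"] True s show False by simp
    qed
    then show ?thesis using True by simp
  next
    case False
    with l q[of "1 / ?l"] have "0 \<le> sqnorm M x - (?r \<bullet> ?r) / ?l"
      by (simp add: power2_eq_square)
    with l False show ?thesis by (simp add: field_simps power2_norm_eq_inner)
  qed
qed

section \<open>The positive semi-definite square root\<close>

text \<open>The defect \<open>y\<close> satisfies \<open>R *v y = - (sqrt l *\<^sub>R y)\<close>, so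
  positivity of \<open>R\<close> forces \<open>y = 0\<close> unless \<open>l = 0\<close>. Hence
  every psd root acts in the same way on an eigenbasis of \<open>M\<close>, which gives uniqueness
  below.\<close>

lemma psd_root_eigenvector:
  assumes R: "sym_psd R" "R ** R = M" and e: "M *v e = l *\<^sub>R e" and l: "0 \<le> l"
  shows "R *v e = sqrt l *\<^sub>R e"
proof -
  have psd: "0 \<le> x \<bullet> (R *v x)" for x using R(1) by (simp add: sym_psd_def)
  have RR: "R *v (R *v e) = l *\<^sub>R e" using R(2) e by (simp add: matrix_vector_mul_assoc)
  define y where "y = R *v e - sqrt l *\<^sub>R e"
  have "R *v y = - (sqrt l *\<^sub>R y)"
    using l by (simp add: y_def matrix_vector_mult_diff_distrib matrix_vector_mult_scaleR RR
        scaleR_diff_right)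
  with psd[of y] have "sqrt l * (y \<bullet> y) \<le> 0" by simp
  moreover have "0 < sqrt l * (y \<bullet> y)" if "l \<noteq> 0" "y \<noteq> 0"
    using that l by simp
  ultimately have "l = 0 \<or> y = 0" by linarith
  moreover have "y = 0" if "l = 0"
  proof -
    have "(R *v e) \<bullet> (R *v e) = e \<bullet> (R *v (R *v e))"
      using R(1) by (intro symmetric_dot) (simp add: sym_psd_def)
    with that RR show ?thesis by (simp add: y_def)
  qed
  ultimately show ?thesis by (auto simp: y_def)
qed

text \<open>Existence comes from an orthonormal eigenbasis, uniqueness from the action of any root
  on that basis; together they make the \<open>THE\<close> in the definition meaningful.\<close>

lemma psd_sqrt:
  fixes M :: "real^'n^'n"
  assumes "sym_psd M"
  shows "sym_psd (psd_sqrt M)" and "psd_sqrt M ** psd_sqrt M = M"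
proof -
  have M: "transpose M = M" "\<And>x. 0 \<le> x \<bullet> (M *v x)" using assms by (auto simp: sym_psd_def)
  from spectral_theorem[of "(*v) M" UNIV] symmetric_dot[OF M(1)]
  obtain E where E: "pairwise orthogonal E" "\<And>e. e \<in> E \<Longrightarrow> norm e = 1"
    "\<And>e. e \<in> E \<Longrightarrow> \<exists>l. M *v e = l *\<^sub>R e" "span E = UNIV" by auto
  have fin: "finite E" using E(1) pairwise_orthogonal_imp_finite by blast
  define k where "k e = e \<bullet> (M *v e)" for e
  have k0: "0 \<le> k e" for e by (simp add: k_def M)
  have Me: "M *v e = k e *\<^sub>R e" if "e \<in> E" for e
    using E(2,3)[OF that] by (auto simp: k_def dot_square_norm)
  \<comment> \<open>The root scales the component along each basis eigenvector by the square root of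
    its eigenvalue.\<close>
  define f where "f x = (\<Sum>e\<in>E. (sqrt (k e) * (e \<bullet> x)) *\<^sub>R e)" for x
  have lin: "linear f" unfolding f_def
    by (intro linear_compose_sum ballI linearI)
       (auto simp: inner_add_right algebra_simps)
  define R where "R = matrix f"
  have Rf: "R *v x = f x" for x unfolding R_def using lin by (simp add: matrix_works)
  have sa: "f x \<bullet> y = x \<bullet> f y" for x y
    by (simp add: f_def inner_sum_left inner_sum_right inner_commute mult_ac)
  have fe: "f e = sqrt (k e) *\<^sub>R e" if "e \<in> E" for e
  proof -
    have "f e = (\<Sum>d\<in>E. if d = e then sqrt (k e) *\<^sub>R e else 0)"
      unfolding f_def using E(1,2) that
      by (intro sum.cong) (auto simp: pairwise_def orthogonal_def dot_square_norm)
    then show ?thesis using fin that by simp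
  qed
  have "sym_psd R"
    unfolding sym_psd_def
  proof (intro conjI allI)
    show "transpose R = R" by (rule symmetric_matrixI) (simp add: Rf sa)
    show "0 \<le> x \<bullet> (R *v x)" for x
      by (simp add: Rf f_def inner_sum_right inner_commute k0 mult.assoc sum_nonneg)
  qed
  moreover have "R ** R = M"
  proof -
    have "f (f x) = M *v x" for x
    proof (rule linear_eq_on_span[where f = "\<lambda>x. f (f x)" and g = "(*v) M"])
      show "linear (\<lambda>x. f (f x))" using linear_compose[OF lin lin] by (simp add: o_def)
      show "f (f e) = M *v e" if "e \<in> E" for e
        using k0[of e] by (simp add: fe Me that linear_scale[OF lin])
      show "x \<in> span E" by (simp add: E)
    qed simp
    then show ?thesis by (simp add: matrix_eq matrix_vector_mul_assoc[symmetric] Rf)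
  qed
  moreover have "Q = R" if "sym_psd Q" "Q ** Q = M" for Q
  proof -
    have "Q *v x = R *v x" for x
    proof (rule linear_eq_on_span[where f = "(*v) Q" and g = "(*v) R"])
      show "Q *v e = R *v e" if "e \<in> E" for e
        using psd_root_eigenvector[OF \<open>sym_psd Q\<close> \<open>Q ** Q = M\<close> Me[OF that] k0]
        by (simp add: Rf fe that)
      show "x \<in> span E" by (simp add: E)
    qed simp_all
    then show ?thesis by (simp add: matrix_eq)
  qed
  ultimately have "\<exists>!S. sym_psd S \<and> S ** S = M" by metis
  from theI'[OF this] show "sym_psd (psd_sqrt M)" "psd_sqrt M ** psd_sqrt M = M"
    unfolding psd_sqrt_def by auto
qed

text \<open>With \<open>?R\<close> the root of the Gram matrix of \<open>transpose A\<close>, the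
  Rayleigh bound and Cauchy-Schwarz bound \<open>sigma_min A * norm x\<close> by
  \<open>norm (?R *v x)\<close>, which equals \<open>norm (transpose A *v x)\<close>.\<close>

lemma sigma_min_bound:
  fixes A :: "real^'n^'p"
  shows "(sigma_min A)\<^sup>2 * (norm x)\<^sup>2 \<le> (norm (transpose A *v x))\<^sup>2"
proof -
  let ?M = "A ** transpose A"
  let ?R = "psd_sqrt ?M"
  have psd: "sym_psd ?M" using gram_psd[of "transpose A"] by simp
  have R: "sym_psd ?R" "transpose ?R = ?R" "?R ** ?R = ?M"
    using psd_sqrt[OF psd] by (auto simp: sym_psd_def)
  have s0: "0 \<le> sigma_min A"
    unfolding sigma_min_def
    using eigenvalue_nonneg[OF R(1)] smallest_eigenvalue_bound(2)[OF R(2)] by blast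
  have "sigma_min A * (norm x * norm x) \<le> x \<bullet> (?R *v x)"
    using smallest_eigenvalue_bound(1)[OF R(2), of x]
    by (simp add: sigma_min_def dot_square_norm power2_eq_square)
  also have "\<dots> \<le> norm x * norm (?R *v x)" by (rule norm_cauchy_schwarz)
  finally have "norm x * (sigma_min A * norm x) \<le> norm x * norm (?R *v x)"
    by (simp add: mult_ac)
  then have "sigma_min A * norm x \<le> norm (?R *v x)"
    by (cases "x = 0") auto
  then have "(sigma_min A * norm x)\<^sup>2 \<le> (norm (?R *v x))\<^sup>2"
    using s0 by (intro power_mono) auto
  also have "\<dots> = x \<bullet> (?M *v x)"
    using gram_dot[of x ?R] R by simp
  also have "\<dots> = (norm (transpose A *v x))\<^sup>2"
    using gram_dot[of x "transpose A"] by simp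
  finally show ?thesis by (simp add: power_mult_distrib)
qed

section \<open>Gradients, subgradients and conjugates\<close>

text \<open>The derivative is represented by the vector of its values on the basis, and uniqueness
  of derivatives justifies the \<open>THE\<close>.\<close>

lemma gderiv_gradient:
  fixes f :: "'a::euclidean_space \<Rightarrow> real"
  assumes "f differentiable (at x)"
  shows "GDERIV f x :> gradient f x"
proof -
  obtain D where D: "(f has_derivative D) (at x)" using assms by (auto simp: differentiable_def)
  interpret D: linear D using D by (rule has_derivative_linear)
  define d where "d = (\<Sum>b\<in>Basis. D b *\<^sub>R b)"
  have "D h = h \<bullet> d" for h
  proof -
    have "D h = D (\<Sum>b\<in>Basis. (h \<bullet> b) *\<^sub>R b)" by (simp add: euclidean_representation)
    also have "\<dots> = h \<bullet> d" by (simp add: D.sum D.scale d_def inner_sum_right mult.commute)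
    finally show ?thesis .
  qed
  then have "D = (\<lambda>h. h \<bullet> d)" by blast
  with D have d: "GDERIV f x :> d" by (simp add: gderiv_def)
  moreover have "e = d" if "GDERIV f x :> e" for e
  proof -
    have "(\<lambda>h. h \<bullet> e) = (\<lambda>h. h \<bullet> d)"
      using that d unfolding gderiv_def by (rule has_derivative_unique)
    then have "(e - d) \<bullet> (e - d) = 0" by (metis inner_diff_right diff_self)
    then show ?thesis by simp
  qed
  ultimately show ?thesis unfolding gradient_def by (rule theI)
qed

text \<open>Restriction to the line through \<open>x\<close> and \<open>y\<close> reduces this to
  the tangent inequality in one variable.\<close>

lemma convex_above_gradient:
  fixes f :: "'a::real_inner \<Rightarrow> real"
  assumes conv: "convex_on UNIV f" and D: "GDERIV f x :> D"
  shows "f x + D \<bullet> (y - x) \<le> f y"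
proof -
  let ?h = "\<lambda>t::real. f (x + t *\<^sub>R (y - x))"
  have "(?h has_derivative (\<lambda>t. (t *\<^sub>R (y - x)) \<bullet> D)) (at 0)"
    using D unfolding gderiv_def
    by (intro has_derivative_compose[where f = "\<lambda>t. x + t *\<^sub>R (y - x)" and g = f, simplified])
       (auto intro!: derivative_eq_intros)
  then have "(?h has_field_derivative D \<bullet> (y - x)) (at 0)"
    by (simp add: has_field_derivative_def inner_commute mult_commute_abs)
  moreover have "convex_on UNIV ?h"
  proof (rule convex_onI)
    fix t u v :: real assume t: "0 < t" "t < 1"
    have "x + ((1 - t) *\<^sub>R u + t *\<^sub>R v) *\<^sub>R (y - x)
      = (1 - t) *\<^sub>R (x + u *\<^sub>R (y - x)) + t *\<^sub>R (x + v *\<^sub>R (y - x))"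
      by (simp add: algebra_simps)
    then show "?h ((1 - t) *\<^sub>R u + t *\<^sub>R v) \<le> (1 - t) * ?h u + t * ?h v"
      using convex_onD[OF conv, of t "x + u *\<^sub>R (y - x)" "x + v *\<^sub>R (y - x)"] t by simp
  qed simp
  ultimately show ?thesis
    using convex_on_imp_above_tangent[of UNIV ?h 0 1 "D \<bullet> (y - x)"] by simp
qed

text \<open>Subtracting the affine minorant leaves a function with a minimum at \<open>x\<close>,
  where its derivative must vanish.\<close>

lemma subgradient_eq_gradient:
  fixes f :: "'a::real_inner \<Rightarrow> real"
  assumes sub: "subgradient (\<lambda>u. ereal (f u)) x \<xi>" and D: "GDERIV f x :> D"
  shows "\<xi> = D"
proof -
  have "((\<lambda>y. f y - \<xi> \<bullet> (y - x)) has_derivative (\<lambda>h. h \<bullet> D - \<xi> \<bullet> h)) (at x)"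
    using D unfolding gderiv_def by (auto intro!: derivative_eq_intros)
  moreover have "f x - \<xi> \<bullet> (x - x) \<le> f y - \<xi> \<bullet> (y - x)" for y
    using sub by (simp add: subgradient_def le_diff_eq)
  ultimately have "(\<lambda>h. h \<bullet> D - \<xi> \<bullet> h) = (\<lambda>h. 0)"
    by (intro has_derivative_local_min) auto
  \<comment> \<open>Evaluate the vanishing derivative in the direction
    \<open>D - \<xi>\<close>.\<close>
  then have "(D - \<xi>) \<bullet> D - \<xi> \<bullet> (D - \<xi>) = 0" by meson
  then have "(D - \<xi>) \<bullet> (D - \<xi>) = 0" by (simp add: inner_diff_right inner_diff_left inner_commute)
  then show ?thesis by simp
qed

lemma nonneg_of_nonneg_perturbation:
  fixes a k :: real
  assumes "\<And>t. 0 < t \<Longrightarrow> t \<le> 1 \<Longrightarrow> 0 \<le> a + t * k"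
  shows "0 \<le> a"
proof (rule tendsto_lowerbound)
  show "((\<lambda>t. a + t * k) \<longlongrightarrow> a) (at_right 0)"
    by (auto intro!: tendsto_eq_intros)
  show "\<forall>\<^sub>F t in at_right 0. 0 \<le> a + t * k"
    using eventually_at_right_real[OF zero_less_one] by eventually_elim (auto intro: assms)
qed simp

text \<open>Fermat's rule for a convex function plus a quadratic. Compare \<open>z\<close> with the
  points on the segment to \<open>y\<close>: convexity bounds \<open>h\<close> there, and the exact
  expansion of \<open>q\<close> with linear part \<open>l\<close> replaces a derivative. Dividing by
  t and letting t tend to 0 gives the claim.\<close>

lemma minimizer_subgradient:
  fixes h :: "'a::real_inner \<Rightarrow> ereal"
  assumes conv: "ereal_convex h" and proper: "\<And>x. h x \<noteq> - \<infinity>" "\<exists>x. h x \<noteq> \<infinity>"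
    and min: "is_arg_min (\<lambda>x. h x + ereal (q x)) (\<lambda>_. True) z"
    and q: "\<And>d t. q (z + t *\<^sub>R d) = q z + t * (l \<bullet> d) + t\<^sup>2 * k d"
  shows "subgradient h z (- l)"
proof -
  have le: "h z + ereal (q z) \<le> h x + ereal (q x)" for x
    using min unfolding is_arg_min_def by (metis not_less)
  obtain x where x: "h x \<noteq> \<infinity>" using proper(2) by blast
  have "h z \<noteq> \<infinity>" using le[of x] x proper(1)[of x] by (cases "h x") auto
  then obtain a where a: "h z = ereal a" using proper(1)[of z] by (cases "h z") auto
  have "h z + ereal (- l \<bullet> (y - z)) \<le> h y" for y
  proof (cases "h y")
    case (real b)
    have "0 \<le> (b - a + l \<bullet> (y - z)) + t * k (y - z)" if t: "0 < t" "t \<le> 1" for t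
    proof -
      have eq: "(1 - t) *\<^sub>R z + t *\<^sub>R y = z + t *\<^sub>R (y - z)" by (simp add: algebra_simps)
      have "h (z + t *\<^sub>R (y - z)) \<le> ereal ((1 - t) * a + t * b)"
        using conv[unfolded ereal_convex_def, rule_format, of t z y] t by (simp add: eq a real)
      then have "h (z + t *\<^sub>R (y - z)) + ereal (q (z + t *\<^sub>R (y - z)))
          \<le> ereal ((1 - t) * a + t * b) + ereal (q (z + t *\<^sub>R (y - z)))"
        by (rule add_right_mono)
      with le[of "z + t *\<^sub>R (y - z)"]
      have "ereal a + ereal (q z) \<le> ereal ((1 - t) * a + t * b) + ereal (q (z + t *\<^sub>R (y - z)))"
        unfolding a by (rule order_trans)
      then have "a + q z \<le> (1 - t) * a + t * b + (q z + t * (l \<bullet> (y - z)) + t\<^sup>2 * k (y - z))"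
        unfolding q by simp
      then have "0 \<le> t * ((b - a + l \<bullet> (y - z)) + t * k (y - z))"
        by (simp add: algebra_simps power2_eq_square)
      with t show ?thesis by (simp add: zero_le_mult_iff)
    qed
    then have "0 \<le> b - a + l \<bullet> (y - z)" by (rule nonneg_of_nonneg_perturbation)
    then show ?thesis by (simp add: a real)
  qed (use proper(1)[of y] in auto)
  then show ?thesis by (simp add: subgradient_def a)
qed

lemma convex_on_imp_ereal_convex:
  assumes "convex_on UNIV f"
  shows "ereal_convex (\<lambda>u. ereal (f u))"
  using convex_onD[OF assms] by (simp add: ereal_convex_def)

text \<open>Equality case of Fenchel's inequality: by the tangent inequality the supremum is
  attained at \<open>x\<close>.\<close>

lemma convex_conjugate_gradient:
  fixes f :: "'a::real_inner \<Rightarrow> real"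
  assumes "convex_on UNIV f" "GDERIV f x :> D"
  shows "convex_conjugate (\<lambda>u. ereal (f u)) D = ereal (D \<bullet> x - f x)"
  unfolding convex_conjugate_def
proof (rule antisym)
  show "(SUP u. ereal (D \<bullet> u) - ereal (f u)) \<le> ereal (D \<bullet> x - f x)"
  proof (rule SUP_least)
    fix u
    show "ereal (D \<bullet> u) - ereal (f u) \<le> ereal (D \<bullet> x - f x)"
      using convex_above_gradient[OF assms, of u] by (simp add: inner_diff_right)
  qed
  show "ereal (D \<bullet> x - f x) \<le> (SUP u. ereal (D \<bullet> u) - ereal (f u))"
    by (rule SUP_upper2[of x]) simp_all
qed

section \<open>Bregman divergences of smooth convex functions\<close>

lemma bregman_ereal:
  "bregman (\<lambda>u. ereal (f u)) \<xi> x y = ereal (f y - f x - \<xi> \<bullet> (y - x))"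
  by (simp add: bregman_def)

text \<open>Both conjugate values are known by Fenchel's equality; substituting them swaps the roles
  of the two points.\<close>

lemma bregman_convex_conjugate:
  fixes f :: "'a::real_inner \<Rightarrow> real"
  assumes "convex_on UNIV f" "GDERIV f x :> D" "GDERIV f y :> E"
  shows "bregman (convex_conjugate (\<lambda>u. ereal (f u))) x D E
    = bregman (\<lambda>u. ereal (f u)) E y x"
  by (simp add: bregman_def convex_conjugate_gradient[OF assms(1,2)]
      convex_conjugate_gradient[OF assms(1,3)] inner_diff_right inner_diff_left
      inner_commute algebra_simps)

lemma smooth_wrtD:
  fixes f :: "'a::euclidean_space \<Rightarrow> real"
  assumes "smooth_wrt L f"
  shows "GDERIV f x :> gradient f x"
    and "f y \<le> f x + gradient f x \<bullet> (y - x) + L / 2 * (norm (y - x))\<^sup>2"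
proof -
  show "GDERIV f x :> gradient f x"
    using assms by (intro gderiv_gradient) (simp add: smooth_wrt_def)
  have "bregman (\<lambda>u. ereal (f u)) (gradient f x) x y \<le> ereal (L / 2 * (norm (x - y))\<^sup>2)"
    using assms by (simp add: smooth_wrt_def)
  then show "f y \<le> f x + gradient f x \<bullet> (y - x) + L / 2 * (norm (y - x))\<^sup>2"
    by (simp add: bregman_ereal norm_minus_commute)
qed

text \<open>Apply the tangent inequality at \<open>x\<close> and the smoothness inequality at \<open>y\<close> to the
  gradient step \<open>y - \<gamma> r\<close>, where \<open>r\<close> is the difference of the two gradients.\<close>

lemma bregman_ge_gradient_diff:
  fixes f :: "'a::euclidean_space \<Rightarrow> real"
  assumes conv: "convex_on UNIV f" and smooth: "smooth_wrt (1 / \<gamma>) f" and "\<gamma> > 0"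
  shows "\<gamma> / 2 * (norm (gradient f y - gradient f x))\<^sup>2 \<le> f y - f x - gradient f x \<bullet> (y - x)"
proof -
  define r where "r = gradient f y - gradient f x"
  let ?z = "y - \<gamma> *\<^sub>R r"
  have "f ?z \<le> f y - \<gamma> * (gradient f y \<bullet> r) + \<gamma> / 2 * (r \<bullet> r)"
    using smooth_wrtD(2)[OF smooth, of ?z y] \<open>\<gamma> > 0\<close>
    by (simp add: power_mult_distrib power2_eq_square dot_square_norm mult_ac)
  moreover have "f x + gradient f x \<bullet> (y - x) - \<gamma> * (gradient f x \<bullet> r) \<le> f ?z"
    using convex_above_gradient[OF conv smooth_wrtD(1)[OF smooth], of x ?z]
    by (simp add: inner_diff_right algebra_simps)
  moreover have "\<gamma> * (gradient f y \<bullet> r) - \<gamma> * (gradient f x \<bullet> r) = \<gamma> * (r \<bullet> r)"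
    by (simp add: r_def inner_diff_left right_diff_distrib)
  ultimately show ?thesis by (simp add: r_def[symmetric] power2_norm_eq_inner)
qed

section \<open>One step of the algorithm\<close>

lemma sqnorm_add_scaleR:
  assumes "transpose M = M"
  shows "sqnorm M (x + t *\<^sub>R d) = sqnorm M x + 2 * t * ((M *v x) \<bullet> d) + t\<^sup>2 * sqnorm M d"
proof -
  have "x \<bullet> (M *v d) = (M *v x) \<bullet> d" "d \<bullet> (M *v x) = (M *v x) \<bullet> d"
    using symmetric_dot[OF assms, of x d] by (simp_all add: inner_commute)
  then show ?thesis
    by (simp add: sqnorm_def matrix_vector_right_distrib matrix_vector_mult_scaleR
        inner_add_left inner_add_right power2_eq_square algebra_simps)
qed

lemma norm_add_scaleR_square:
  fixes x :: "'a::real_inner"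
  shows "(norm (x + t *\<^sub>R d))\<^sup>2 = (norm x)\<^sup>2 + 2 * t * (x \<bullet> d) + t\<^sup>2 * (norm d)\<^sup>2"
  unfolding power2_norm_eq_inner
  by (simp add: inner_add_left inner_add_right inner_commute[of d x] power2_eq_square algebra_simps)

text \<open>The residual involves the old \<open>w (t - 1)\<close>, so the multiplier seen by
  \<open>g\<close> is an intermediate one and not \<open>\<alpha> t\<close>.\<close>

lemma padmm_v_step:
  fixes g :: "real^'m \<Rightarrow> ereal"
  assumes "padmm \<phi> g A B c \<rho> G H w v \<alpha>" "t \<ge> 1" "transpose G = G"
    and "\<And>x. g x \<noteq> - \<infinity>" "\<exists>x. g x \<noteq> \<infinity>" "ereal_convex g"
  shows "subgradient g (v t) (transpose B *v (\<alpha> (t - 1) + \<rho> *\<^sub>R (A *v w (t - 1) - B *v v t - c))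
    - \<rho> *\<^sub>R (G *v (v t - v (t - 1))))"
proof -
  define r z where "r = A *v w (t - 1) - B *v v t - c" and "z = v t - v (t - 1)"
  \<comment> \<open>Gradient at \<open>v t\<close> of the quadratic part of the objective.\<close>
  let ?l = "- (transpose B *v (\<alpha> (t - 1) + \<rho> *\<^sub>R r) - \<rho> *\<^sub>R (G *v z))"
  have "subgradient g (v t) (- ?l)"
  proof (rule minimizer_subgradient[OF assms(6,4,5)])
    show "is_arg_min (\<lambda>x. g x + ereal (- (\<alpha> (t - 1) \<bullet> (B *v x))
        + \<rho> / 2 * (norm (A *v w (t - 1) - B *v x - c))\<^sup>2 + \<rho> / 2 * sqnorm G (x - v (t - 1))))
      (\<lambda>_. True) (v t)"
      using assms(1)[unfolded padmm_def, rule_format, OF assms(2)] by (rule conjunct1)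
    fix d s
    have 1: "A *v w (t - 1) - B *v (v t + s *\<^sub>R d) - c = r + s *\<^sub>R (- (B *v d))"
      by (simp add: r_def matrix_vector_right_distrib matrix_vector_mult_scaleR)
    have 2: "v t + s *\<^sub>R d - v (t - 1) = z + s *\<^sub>R d" by (simp add: z_def)
    have 3: "?l \<bullet> d = - (\<alpha> (t - 1) \<bullet> (B *v d)) - \<rho> * (r \<bullet> (B *v d)) + \<rho> * ((G *v z) \<bullet> d)"
      unfolding inner_minus_left inner_diff_left transpose_matrix_dot by (simp add: inner_add_left)
    have 4: "\<alpha> (t - 1) \<bullet> (B *v (v t + s *\<^sub>R d)) = \<alpha> (t - 1) \<bullet> (B *v v t) + s * (\<alpha> (t - 1) \<bullet> (B *v d))"
      by (simp add: matrix_vector_right_distrib matrix_vector_mult_scaleR inner_add_right)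
    show "- (\<alpha> (t - 1) \<bullet> (B *v (v t + s *\<^sub>R d)))
        + \<rho> / 2 * (norm (A *v w (t - 1) - B *v (v t + s *\<^sub>R d) - c))\<^sup>2
        + \<rho> / 2 * sqnorm G (v t + s *\<^sub>R d - v (t - 1))
      = - (\<alpha> (t - 1) \<bullet> (B *v v t)) + \<rho> / 2 * (norm (A *v w (t - 1) - B *v v t - c))\<^sup>2
        + \<rho> / 2 * sqnorm G (v t - v (t - 1))
        + s * (?l \<bullet> d) + s\<^sup>2 * (\<rho> / 2 * ((norm (B *v d))\<^sup>2 + sqnorm G d))"
      unfolding 1 2 3 4 norm_add_scaleR_square sqnorm_add_scaleR[OF assms(3)]
      unfolding r_def[symmetric] z_def[symmetric] by (simp add: field_simps)
  qed
  then show ?thesis by (simp only: r_def z_def minus_minus)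
qed

text \<open>The multiplier update absorbs the gradient of the penalty, so the optimality condition
  contains \<open>\<alpha> t\<close> in place of \<open>\<alpha> (t - 1)\<close>.\<close>

lemma padmm_w_step:
  fixes \<phi> :: "real^'n \<Rightarrow> real"
  assumes "padmm \<phi> g A B c \<rho> G H w v \<alpha>" "t \<ge> 1" "transpose H = H"
    and "convex_on UNIV \<phi>" "GDERIV \<phi> (w t) :> D"
  shows "D = - (transpose A *v \<alpha> t + H *v (w t - w (t - 1)))"
proof -
  define r z where "r = A *v w t - B *v v t - c" and "z = w t - w (t - 1)"
  let ?l = "transpose A *v \<alpha> t + H *v z"
  have \<alpha>: "\<alpha> t = \<alpha> (t - 1) + \<rho> *\<^sub>R r" 
    using assms(1)[unfolded padmm_def, rule_format, OF assms(2)] unfolding r_def by (elim conjE)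
  have "subgradient (\<lambda>u. ereal (\<phi> u)) (w t) (- ?l)"
  proof (rule minimizer_subgradient)
    show "ereal_convex (\<lambda>u. ereal (\<phi> u))" by (rule convex_on_imp_ereal_convex) fact
    have "is_arg_min (\<lambda>x. \<phi> x + \<alpha> (t - 1) \<bullet> (A *v x)
        + \<rho> / 2 * (norm (A *v x - B *v v t - c))\<^sup>2 + 1 / 2 * sqnorm H (x - w (t - 1)))
      (\<lambda>_. True) (w t)"
      using assms(1)[unfolded padmm_def, rule_format, OF assms(2)] by (elim conjE)
    then show "is_arg_min (\<lambda>x. ereal (\<phi> x) + ereal (\<alpha> (t - 1) \<bullet> (A *v x)
        + \<rho> / 2 * (norm (A *v x - B *v v t - c))\<^sup>2 + 1 / 2 * sqnorm H (x - w (t - 1))))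
      (\<lambda>_. True) (w t)"
      by (simp only: is_arg_min_linorder plus_ereal.simps ereal_less_eq add.assoc simp_thms)
    fix d s
    have 1: "A *v (w t + s *\<^sub>R d) - B *v v t - c = r + s *\<^sub>R (A *v d)"
      by (simp add: r_def matrix_vector_right_distrib matrix_vector_mult_scaleR)
    have 2: "w t + s *\<^sub>R d - w (t - 1) = z + s *\<^sub>R d" by (simp add: z_def)
    have 3: "?l \<bullet> d = \<alpha> (t - 1) \<bullet> (A *v d) + \<rho> * (r \<bullet> (A *v d)) + (H *v z) \<bullet> d"
      unfolding inner_add_left[of "transpose A *v _"] transpose_matrix_dot \<alpha>
      by (simp add: inner_add_left)
    have 4: "\<alpha> (t - 1) \<bullet> (A *v (w t + s *\<^sub>R d)) = \<alpha> (t - 1) \<bullet> (A *v w t) + s * (\<alpha> (t - 1) \<bullet> (A *v d))"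
      by (simp add: matrix_vector_right_distrib matrix_vector_mult_scaleR inner_add_right)
    show "\<alpha> (t - 1) \<bullet> (A *v (w t + s *\<^sub>R d))
        + \<rho> / 2 * (norm (A *v (w t + s *\<^sub>R d) - B *v v t - c))\<^sup>2
        + 1 / 2 * sqnorm H (w t + s *\<^sub>R d - w (t - 1))
      = \<alpha> (t - 1) \<bullet> (A *v w t) + \<rho> / 2 * (norm (A *v w t - B *v v t - c))\<^sup>2
        + 1 / 2 * sqnorm H (w t - w (t - 1))
        + s * (?l \<bullet> d) + s\<^sup>2 * (\<rho> / 2 * (norm (A *v d))\<^sup>2 + 1 / 2 * sqnorm H d)"
      unfolding 1 2 3 4 norm_add_scaleR_square sqnorm_add_scaleR[OF assms(3)]
      unfolding r_def[symmetric] z_def[symmetric] by (simp add: field_simps)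
  qed auto
  from subgradient_eq_gradient[OF this assms(5)] show ?thesis by (simp only: z_def)
qed

section \<open>Contraction of the energy\<close>

text \<open>The right side minus the left side is
  \<open>(norm (q *\<^sub>R x - p *\<^sub>R y))\<^sup>2 / (p * q)\<close>.\<close>

lemma norm_add_square_weighted:
  fixes x y :: "'a::real_inner"
  assumes "p > 0" "q > 0"
  shows "(norm (x + y))\<^sup>2 \<le> (p + q) * ((norm x)\<^sup>2 / p + (norm y)\<^sup>2 / q)"
proof -
  have 1: "(norm (q *\<^sub>R x + (- p) *\<^sub>R y))\<^sup>2
      = q\<^sup>2 * (norm x)\<^sup>2 + 2 * (- p) * (q * (x \<bullet> y)) + p\<^sup>2 * (norm y)\<^sup>2"
    unfolding norm_add_scaleR_square by (simp add: power_mult_distrib)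
  have 2: "(norm (x + y))\<^sup>2 = (norm x)\<^sup>2 + 2 * (x \<bullet> y) + (norm y)\<^sup>2"
    using norm_add_scaleR_square[of x 1 y] by simp
  have 3: "(p + q) * (X / p + Y / q) - (X + 2 * z + Y)
      = (q\<^sup>2 * X + 2 * (- p) * (q * z) + p\<^sup>2 * Y) / (p * q)" for X Y z :: real
    using assms by (simp add: field_simps power2_eq_square)
  have "0 \<le> (norm (q *\<^sub>R x + (- p) *\<^sub>R y))\<^sup>2 / (p * q)" using assms by simp
  then show ?thesis unfolding 1 2 3[symmetric] by simp
qed

text \<open>Twice the Lyapunov function of the iteration. Only the multiplier and \<open>G\<close>
  parts carry \<open>1 + \<theta>\<close>, so that dividing by this factor leaves them with the
  weights in which they telescope.\<close>

definition energy ::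
  "real \<Rightarrow> real \<Rightarrow> real^'p^'p \<Rightarrow> real^'m^'m \<Rightarrow> real^'p \<Rightarrow> real^'p \<Rightarrow> real^'m \<Rightarrow> real" where
  "energy \<rho> \<theta> Ht G a e d =
    \<rho> * (norm a)\<^sup>2 + sqnorm Ht a + (1 + \<theta>) / \<rho> * (norm e)\<^sup>2 + \<rho> * (1 + \<theta>) * sqnorm G d"

text \<open>Pays for the extra \<open>\<theta>\<close> on the multiplier part.
  \<open>sigma_min A\<close> passes from \<open>e\<close> to \<open>transpose A *v e\<close>, which
  is \<open>?x - ?y\<close>; the Young weights 1 and \<open>?l\<close> add up to the denominator in
  the first bound on \<open>\<theta>\<close>.\<close>

lemma dual_energy_bound:
  fixes A :: "real^'n^'p" and H :: "real^'n^'n"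
  assumes H: "sym_psd H" "H = transpose A ** Ht ** A"
    and pos: "\<gamma> > 0" "\<rho> > 0"
    and \<theta>: "\<theta> * (\<gamma> * largest_eigenvalue H + 1) \<le> \<gamma> * \<rho> * (sigma_min A)\<^sup>2"
  shows "\<theta> / \<rho> * (norm e)\<^sup>2
    \<le> \<gamma> * (norm (transpose A *v (e + Ht *v (A *v \<delta>))))\<^sup>2 + sqnorm Ht (A *v \<delta>)"
proof -
  let ?l = "\<gamma> * largest_eigenvalue H"
  let ?x = "transpose A *v (e + Ht *v (A *v \<delta>))" and ?y = "H *v \<delta>"
  have l: "0 \<le> ?l" using largest_eigenvalue_nonneg[OF H(1)] pos by simp
  have Hd: "?y = transpose A *v (Ht *v (A *v \<delta>))"
    by (simp only: H(2) matrix_vector_mul_assoc[symmetric])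
  have Hs: "sqnorm H \<delta> = sqnorm Ht (A *v \<delta>)"
    using transpose_matrix_dot[of A "Ht *v (A *v \<delta>)" \<delta>]
    unfolding sqnorm_def Hd by (simp only: inner_commute)
  have y: "\<gamma> * (norm ?y)\<^sup>2 \<le> ?l * sqnorm Ht (A *v \<delta>)"
    using mult_left_mono[OF psd_norm_image_le[OF H(1), of \<delta>], of \<gamma>] pos
    by (simp add: Hs mult.assoc)
  have "transpose A *v e = ?x + - ?y"
    by (simp add: Hd matrix_vector_right_distrib del: transpose_matrix_vector)
  moreover have "\<gamma> * (norm (?x + - ?y))\<^sup>2
      \<le> (1 + ?l) * (\<gamma> * (norm ?x)\<^sup>2 + sqnorm Ht (A *v \<delta>))"
  \<comment> \<open>Young's inequality needs a positive weight \<open>?l\<close>; if it is zero,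
    then \<open>y\<close> already forces \<open>?y = 0\<close>.\<close>
  proof (cases "?l = 0")
    case True
    with y pos have "?y = 0" by (simp add: mult_le_0_iff)
    moreover have "0 \<le> sqnorm Ht (A *v \<delta>)"
      unfolding Hs[symmetric] using H(1) by (simp add: sym_psd_def sqnorm_def)
    ultimately show ?thesis unfolding True by simp
  next
    case False
    with l have l': "?l > 0" by linarith
    have "\<gamma> * (norm (?x + - ?y))\<^sup>2 \<le> \<gamma> * ((1 + ?l) * ((norm ?x)\<^sup>2 / 1 + (norm (- ?y))\<^sup>2 / ?l))"
      using pos by (intro mult_left_mono norm_add_square_weighted l') auto
    also have "\<dots> = (1 + ?l) * (\<gamma> * (norm ?x)\<^sup>2 + \<gamma> * (norm ?y)\<^sup>2 / ?l)"
      by (simp only: mult.left_commute[of \<gamma> "1 + ?l"] distrib_left[of \<gamma>]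
          times_divide_eq_right div_by_1 norm_minus_cancel)
    also have "\<dots> \<le> (1 + ?l) * (\<gamma> * (norm ?x)\<^sup>2 + sqnorm Ht (A *v \<delta>))"
    proof (intro mult_left_mono add_left_mono)
      show "\<gamma> * (norm ?y)\<^sup>2 / ?l \<le> sqnorm Ht (A *v \<delta>)"
        unfolding pos_divide_le_eq[OF l'] using y by (simp only: mult.commute[of _ ?l])
      show "0 \<le> 1 + ?l" using l' by linarith
    qed
    finally show ?thesis .
  qed
  moreover have "\<theta> * (?l + 1) * (norm e)\<^sup>2 \<le> \<gamma> * \<rho> * (norm (transpose A *v e))\<^sup>2"
  proof -
    have "\<theta> * (?l + 1) * (norm e)\<^sup>2 \<le> \<gamma> * \<rho> * (sigma_min A)\<^sup>2 * (norm e)\<^sup>2"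
      by (intro mult_right_mono \<theta>) simp
    also have "\<dots> \<le> \<gamma> * \<rho> * (norm (transpose A *v e))\<^sup>2"
      using mult_left_mono[OF sigma_min_bound[of A e], of "\<gamma> * \<rho>"] pos by (simp add: mult.assoc)
    finally show ?thesis .
  qed
  ultimately have "(1 + ?l) * (\<theta> * (norm e)\<^sup>2)
      \<le> (1 + ?l) * (\<rho> * (\<gamma> * (norm ?x)\<^sup>2 + sqnorm Ht (A *v \<delta>)))"
    using pos by (smt (verit, ccfv_SIG) mult.assoc mult.commute mult_left_mono)
  then have "\<theta> * (norm e)\<^sup>2 \<le> \<rho> * (\<gamma> * (norm ?x)\<^sup>2 + sqnorm Ht (A *v \<delta>))"
    by (rule mult_left_le_imp_le) (use l in simp)
  then show ?thesis using pos by (simp add: pos_divide_le_eq mult.commute)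
qed

text \<open>The Young weights \<open>1 - s\<close> and \<open>\<theta> + s\<close> add up to \<open>1 + \<theta>\<close>, which cancels the
  denominator of \<open>\<theta> / (1 + \<theta>)\<close>.\<close>

lemma primal_energy_bound:
  fixes B :: "real^'m^'p" and G :: "real^'m^'m" and Ht :: "real^'p^'p"
  assumes Ht: "sym_psd Ht" and pos: "\<rho> > 0" "\<theta> > 0" and s: "0 \<le> s" "s < 1"
    and \<theta>1: "\<theta> * largest_eigenvalue Ht \<le> s * \<rho>"
    and \<theta>2: "\<theta> * ((\<rho> + largest_eigenvalue Ht) * (largest_singular_value B)\<^sup>2
      + (1 - s) * \<rho> * largest_singular_value G) \<le> (1 - s) * \<mu>"
  shows "\<theta> / (1 + \<theta>) * (\<rho> * (norm a)\<^sup>2 + sqnorm Ht a) + \<theta> * \<rho> * sqnorm G d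
    \<le> \<rho> * (norm (a - B *v d))\<^sup>2 + \<mu> * (norm d)\<^sup>2"
proof -
  let ?h = "largest_eigenvalue Ht" and ?b = "B *v d"
  let ?u = "a - ?b"
  let ?k = "\<theta> * (\<rho> + ?h)"
  have h: "0 \<le> ?h" by (rule largest_eigenvalue_nonneg[OF Ht])
  \<comment> \<open>The second bound on \<open>\<theta>\<close> enters here: \<open>\<theta>\<close>
    times the largest eigenvalue of \<open>Ht\<close> is at most \<open>s * \<rho>\<close>.\<close>
  have k: "0 \<le> ?k" "?k \<le> \<rho> * (\<theta> + s)" using pos h \<theta>1 by (auto simp: algebra_simps)
  have "sqnorm Ht a \<le> ?h * (norm a)\<^sup>2"
    using largest_eigenvalue_bound(1)[of Ht a] Ht
    by (simp add: sqnorm_def sym_psd_def power2_norm_eq_inner)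
  then have "\<theta> / (1 + \<theta>) * (\<rho> * (norm a)\<^sup>2 + sqnorm Ht a)
      \<le> \<theta> / (1 + \<theta>) * (\<rho> * (norm a)\<^sup>2 + ?h * (norm a)\<^sup>2)"
    using pos by (intro mult_left_mono add_left_mono) auto
  also have "\<dots> = ?k / (1 + \<theta>) * (norm (?b + ?u))\<^sup>2"
    by (simp add: algebra_simps add_divide_distrib)
  also have "\<dots> \<le> ?k / (1 + \<theta>) * (((1 - s) + (\<theta> + s)) * ((norm ?b)\<^sup>2 / (1 - s) + (norm ?u)\<^sup>2 / (\<theta> + s)))"
    using k pos s by (intro mult_left_mono norm_add_square_weighted) auto
  also have "\<dots> = ?k * (norm ?b)\<^sup>2 / (1 - s) + ?k * (norm ?u)\<^sup>2 / (\<theta> + s)"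
  proof -
    have "(1 - s) + (\<theta> + s) = 1 + \<theta>" "1 + \<theta> \<noteq> 0" using pos by auto
    moreover from this have "?k / (1 + \<theta>) * ((1 + \<theta>) * y) = ?k * y" for y by simp
    ultimately show ?thesis by (simp only: distrib_left[of ?k] times_divide_eq_right[of ?k])
  qed
  also have "\<dots> \<le> ?k * ((largest_singular_value B)\<^sup>2 * (norm d)\<^sup>2) / (1 - s) + \<rho> * (norm ?u)\<^sup>2"
  proof (rule add_mono)
    have "(norm ?b)\<^sup>2 \<le> (largest_singular_value B * norm d)\<^sup>2"
      by (intro power_mono largest_singular_value_bound) simp
    then show "?k * (norm ?b)\<^sup>2 / (1 - s) \<le> ?k * ((largest_singular_value B)\<^sup>2 * (norm d)\<^sup>2) / (1 - s)"
      using k s by (intro divide_right_mono mult_left_mono) (auto simp: power_mult_distrib)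
    have "?k * (norm ?u)\<^sup>2 \<le> \<rho> * (\<theta> + s) * (norm ?u)\<^sup>2"
      by (intro mult_right_mono k) simp
    then show "?k * (norm ?u)\<^sup>2 / (\<theta> + s) \<le> \<rho> * (norm ?u)\<^sup>2"
      using pos s by (simp add: pos_divide_le_eq mult_ac)
  qed
  finally have 1: "\<theta> / (1 + \<theta>) * (\<rho> * (norm a)\<^sup>2 + sqnorm Ht a)
    \<le> ?k * (largest_singular_value B)\<^sup>2 / (1 - s) * (norm d)\<^sup>2 + \<rho> * (norm ?u)\<^sup>2"
    by (simp add: mult_ac)
  have 2: "\<theta> * \<rho> * sqnorm G d \<le> \<theta> * \<rho> * largest_singular_value G * (norm d)\<^sup>2"
    using mult_left_mono[OF psd_form_le_largest_singular_value[of G d], of "\<theta> * \<rho>"] pos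
    by (simp add: mult.assoc)
  \<comment> \<open>This is the third bound on \<open>\<theta>\<close>, divided by
    \<open>1 - s\<close>.\<close>
  have "?k * (largest_singular_value B)\<^sup>2 / (1 - s) + \<theta> * \<rho> * largest_singular_value G \<le> \<mu>"
    using \<theta>2 s by (simp add: field_simps)
  then have "(?k * (largest_singular_value B)\<^sup>2 / (1 - s) + \<theta> * \<rho> * largest_singular_value G)
      * (norm d)\<^sup>2 \<le> \<mu> * (norm d)\<^sup>2"
    by (intro mult_right_mono) auto
  with 1 2 show ?thesis unfolding distrib_right by linarith
qed

text \<open>Expand the norm of \<open>e\<close> along the multiplier update and polarize the rest.
  Besides the telescoping differences only the residual in \<open>a0 - b\<close> survives.\<close>

lemma augmented_lagrangian_identity:
  fixes a a0 b e e0 :: "'a::real_inner"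
  assumes "\<rho> > 0" and e: "e = e0 + \<rho> *\<^sub>R (a - b)"
  shows "(e0 + \<rho> *\<^sub>R (a0 - b)) \<bullet> b - e \<bullet> a
    = ((norm e0)\<^sup>2 / \<rho> - (norm e)\<^sup>2 / \<rho> + \<rho> * (norm a0)\<^sup>2 - \<rho> * (norm a)\<^sup>2
      - \<rho> * (norm (a0 - b))\<^sup>2) / 2"
proof -
  define u where "u = a - b"
  have "(norm e)\<^sup>2 = (norm e0)\<^sup>2 + 2 * \<rho> * (e0 \<bullet> u) + \<rho>\<^sup>2 * (norm u)\<^sup>2"
    unfolding e u_def[symmetric] by (rule norm_add_scaleR_square)
  then have 1: "(norm e0)\<^sup>2 / \<rho> - (norm e)\<^sup>2 / \<rho> = - 2 * (e0 \<bullet> u) - \<rho> * (norm u)\<^sup>2"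
    using \<open>\<rho> > 0\<close> by (simp add: field_simps power2_eq_square)
  have sq: "(norm (x - y))\<^sup>2 = x \<bullet> x - 2 * (x \<bullet> y) + y \<bullet> y" for x y :: 'a
    by (simp add: power2_norm_eq_inner inner_diff_left inner_diff_right inner_commute[of y x])
  have "(e0 + \<rho> *\<^sub>R (a0 - b)) \<bullet> b - e \<bullet> a
      = - (e0 \<bullet> u) + \<rho> * (a0 \<bullet> b - b \<bullet> b - a \<bullet> a + a \<bullet> b)"
    by (simp add: e u_def inner_add_left inner_diff_left inner_diff_right inner_commute[of b a]
        right_diff_distrib distrib_left)
  also have "\<dots> = (- 2 * (e0 \<bullet> u) - \<rho> * (a \<bullet> a - 2 * (a \<bullet> b) + b \<bullet> b)
      + \<rho> * (a0 \<bullet> a0) - \<rho> * (a \<bullet> a) - \<rho> * (a0 \<bullet> a0 - 2 * (a0 \<bullet> b) + b \<bullet> b)) / 2"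
    by (simp add: right_diff_distrib distrib_left)
  finally show ?thesis unfolding 1 unfolding u_def sq unfolding power2_norm_eq_inner .
qed

lemma symmetric_form_polarization:
  assumes "transpose M = M"
  shows "2 * ((M *v (x - y)) \<bullet> x) = sqnorm M x - sqnorm M y + sqnorm M (x - y)"
  using sqnorm_add_scaleR[OF assms, of x "-1" "x - y"] symmetric_dot[OF assms, of "x - y" x]
  by (simp add: inner_commute[of "x - y"])

text \<open>All vectors are deviations from the optimum; \<open>- p\<close> and \<open>r\<close>
  stand for the differences of the gradients of the smooth term and of the subgradients of the other
  term.\<close>

lemma energy_contraction:
  fixes A :: "real^'n^'p" and B :: "real^'m^'p"
    and G :: "real^'m^'m" and H :: "real^'n^'n" and Ht :: "real^'p^'p"
  assumes psd: "sym_psd G" "sym_psd H" "sym_psd Ht" and H: "H = transpose A ** Ht ** A"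
    and pos: "\<gamma> > 0" "\<rho> > 0" "\<theta> > 0" and s: "0 \<le> s" "s < 1"
    and \<theta>: "\<theta> * (\<gamma> * largest_eigenvalue H + 1) \<le> \<gamma> * \<rho> * (sigma_min A)\<^sup>2"
      "\<theta> * largest_eigenvalue Ht \<le> s * \<rho>"
      "\<theta> * ((\<rho> + largest_eigenvalue Ht) * (largest_singular_value B)\<^sup>2
        + (1 - s) * \<rho> * largest_singular_value G) \<le> (1 - s) * \<mu>"
    and e: "e = e0 + \<rho> *\<^sub>R (A *v x - B *v d)"
    and p: "p = transpose A *v (e + Ht *v (A *v (x - x0)))"
    and r: "r = transpose B *v (e0 + \<rho> *\<^sub>R (A *v x0 - B *v d)) - \<rho> *\<^sub>R (G *v (d - d0))"
  shows "- (p \<bullet> x) - \<gamma> / 2 * (norm p)\<^sup>2 + r \<bullet> d - \<mu> / 2 * (norm d)\<^sup>2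
      + energy \<rho> \<theta> Ht G (A *v x) e d / 2
    \<le> energy \<rho> \<theta> Ht G (A *v x0) e0 d0 / 2 / (1 + \<theta>)"
proof -
  have sym: "transpose G = G" "transpose Ht = Ht" using psd by (auto simp: sym_psd_def)
  define a a0 b where "a = A *v x" and "a0 = A *v x0" and "b = B *v d"
  have px: "p \<bullet> x = e \<bullet> a + (Ht *v (a - a0)) \<bullet> a"
    unfolding p transpose_matrix_dot a_def a0_def
    by (simp add: inner_add_left matrix_vector_mult_diff_distrib)
  have rd: "r \<bullet> d = (e0 + \<rho> *\<^sub>R (a0 - b)) \<bullet> b - \<rho> * ((G *v (d - d0)) \<bullet> d)"
    unfolding r a0_def b_def inner_diff_left[of "transpose B *v _"] transpose_matrix_dot by simp
  have 1: "(e0 + \<rho> *\<^sub>R (a0 - b)) \<bullet> b - e \<bullet> a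
    = ((norm e0)\<^sup>2 / \<rho> - (norm e)\<^sup>2 / \<rho> + \<rho> * (norm a0)\<^sup>2 - \<rho> * (norm a)\<^sup>2
      - \<rho> * (norm (a0 - b))\<^sup>2) / 2"
    using e by (intro augmented_lagrangian_identity pos) (simp add: a_def b_def)
  have 2: "2 * ((Ht *v (a - a0)) \<bullet> a) = sqnorm Ht a - sqnorm Ht a0 + sqnorm Ht (a - a0)"
    by (rule symmetric_form_polarization[OF sym(2)])
  \<comment> \<open>Polarization, with the nonnegative residual \<open>sqnorm G (d - d0)\<close>
    dropped.\<close>
  have "2 * ((G *v (d - d0)) \<bullet> d) \<ge> sqnorm G d - sqnorm G d0"
    using symmetric_form_polarization[OF sym(1), of d d0] psd(1)
    by (simp add: sym_psd_def sqnorm_def)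
  then have "\<rho> * (2 * ((G *v (d - d0)) \<bullet> d)) \<ge> \<rho> * (sqnorm G d - sqnorm G d0)"
    using pos by (intro mult_left_mono) auto
  then have 3: "2 * (\<rho> * ((G *v (d - d0)) \<bullet> d)) \<ge> \<rho> * sqnorm G d - \<rho> * sqnorm G d0"
    by (simp add: algebra_simps)
  have 4: "\<theta> / \<rho> * (norm e)\<^sup>2 \<le> \<gamma> * (norm p)\<^sup>2 + sqnorm Ht (a - a0)"
    using dual_energy_bound[OF psd(2) H pos(1,2) \<theta>(1), of e "x - x0"]
    by (simp add: p a_def a0_def matrix_vector_mult_diff_distrib)
  have 5: "\<theta> / (1 + \<theta>) * (\<rho> * (norm a0)\<^sup>2 + sqnorm Ht a0) + \<theta> * \<rho> * sqnorm G d
    \<le> \<rho> * (norm (a0 - b))\<^sup>2 + \<mu> * (norm d)\<^sup>2"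
    unfolding b_def by (rule primal_energy_bound[OF psd(3) pos(2,3) s \<theta>(2,3)])
  \<comment> \<open>Dividing the old energy costs the \<open>a0\<close> part the share
    \<open>\<theta> / (1 + \<theta>)\<close>, which \<open>5\<close> pays for. The surplus in the
    new energy, isolated in \<open>7\<close>, is covered by \<open>4\<close> for \<open>e\<close>
    and by \<open>5\<close> for \<open>d\<close>.\<close>
  have 6: "energy \<rho> \<theta> Ht G a0 e0 d0 / (1 + \<theta>)
    = \<rho> * (norm a0)\<^sup>2 + sqnorm Ht a0 - \<theta> / (1 + \<theta>) * (\<rho> * (norm a0)\<^sup>2 + sqnorm Ht a0)
      + (norm e0)\<^sup>2 / \<rho> + \<rho> * sqnorm G d0"
  proof -
    define X Y where "X = \<rho> * (norm a0)\<^sup>2 + sqnorm Ht a0"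
      and "Y = (norm e0)\<^sup>2 / \<rho> + \<rho> * sqnorm G d0"
    have "energy \<rho> \<theta> Ht G a0 e0 d0 = X + (1 + \<theta>) * Y"
      by (simp only: X_def Y_def energy_def distrib_left[of "1 + \<theta>"]
          mult.commute[of \<rho> "1 + \<theta>"] mult.assoc times_divide_eq_left times_divide_eq_right
          add.assoc)
    moreover have "(X + (1 + \<theta>) * Y) / (1 + \<theta>) = X - \<theta> / (1 + \<theta>) * X + Y"
      using pos by (simp add: field_simps)
    ultimately show ?thesis by (simp add: X_def Y_def)
  qed
  have 7: "energy \<rho> \<theta> Ht G a e d = \<rho> * (norm a)\<^sup>2 + sqnorm Ht a
      + (norm e)\<^sup>2 / \<rho> + \<theta> / \<rho> * (norm e)\<^sup>2 + \<rho> * sqnorm G d + \<theta> * \<rho> * sqnorm G d"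
    by (simp add: energy_def add_divide_distrib distrib_left distrib_right mult.commute[of \<theta> \<rho>])
  have 8: "2 * (\<gamma> / 2 * (norm p)\<^sup>2) = \<gamma> * (norm p)\<^sup>2"
    "2 * (\<mu> / 2 * (norm d)\<^sup>2) = \<mu> * (norm d)\<^sup>2"
    by simp_all
  have "2 * (- (p \<bullet> x) - \<gamma> / 2 * (norm p)\<^sup>2 + r \<bullet> d - \<mu> / 2 * (norm d)\<^sup>2)
      + energy \<rho> \<theta> Ht G a e d \<le> energy \<rho> \<theta> Ht G a0 e0 d0 / (1 + \<theta>)"
    using px rd 1 2 3 4 5 6 7 8 by argo
  moreover have "energy \<rho> \<theta> Ht G a0 e0 d0 / 2 / (1 + \<theta>)
      = energy \<rho> \<theta> Ht G a0 e0 d0 / (1 + \<theta>) / 2"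
    by simp
  ultimately show ?thesis unfolding a_def a0_def by argo
qed

section \<open>Summation over the iterations\<close>

lemma geometric_telescope:
  fixes D E :: "nat \<Rightarrow> real"
  assumes "q > 0" and step: "\<And>t. t \<ge> 1 \<Longrightarrow> D t + E t \<le> E (t - 1) / q"
  shows "(\<Sum>t=1..T. q powi (int t - int T) * D t) + E T \<le> q powi (- int T) * E 0"
proof (induction T)
  case (Suc T)
  \<comment> \<open>Raising the horizon by one divides all earlier weights by \<open>q\<close>, the
    factor that the one-step bound puts on the old energy.\<close>
  have shift: "q powi (i - int (Suc T)) = q powi (i - int T) / q" for i
    using \<open>q > 0\<close> power_int_diff[of q "i - int T" 1] by (simp add: algebra_simps)
  have "(\<Sum>t=1..Suc T. q powi (int t - int (Suc T)) * D t) + E (Suc T)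
    = (\<Sum>t=1..T. q powi (int t - int T) * D t) / q + (D (Suc T) + E (Suc T))"
    unfolding shift using \<open>q > 0\<close> by (simp add: sum_divide_distrib power_int_diff)
  also have "\<dots> \<le> (\<Sum>t=1..T. q powi (int t - int T) * D t) / q + E T / q"
    using step[of "Suc T"] by simp
  also have "\<dots> = ((\<Sum>t=1..T. q powi (int t - int T) * D t) + E T) / q"
    by (simp add: add_divide_distrib)
  also have "\<dots> \<le> q powi (- int T) * E 0 / q"
    using Suc.IH \<open>q > 0\<close> by (intro divide_right_mono) auto
  also have "\<dots> = q powi (- int (Suc T)) * E 0"
    using shift[of 0] by simp
  finally show ?case .
qed simp

text \<open>A zero denominator makes the hypothesis on \<open>x\<close> empty, but the product is
  then 0 and \<open>a\<close> is nonnegative.\<close>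

lemma ext_frac_bound:
  assumes "ereal x \<le> ext_frac a b" "0 \<le> a" "0 \<le> b"
  shows "x * b \<le> a"
  using assms by (cases "b = 0") (auto simp: ext_frac_def pos_le_divide_eq)



theorem corollary3p1:
  fixes \<phi> :: "real^'n \<Rightarrow> real" and g :: "real^'m \<Rightarrow> ereal"
    and A :: "real^'n^'p" and B :: "real^'m^'p" and c :: "real^'p"
    and G :: "real^'m^'m" and H :: "real^'n^'n" and Ht :: "real^'p^'p"
    and \<gamma> \<mu> \<rho> s \<theta> :: real
    and w\<^sub>s :: "real^'n" and v\<^sub>s :: "real^'m" and \<alpha>\<^sub>s :: "real^'p"
    and w :: "nat \<Rightarrow> real^'n" and v :: "nat \<Rightarrow> real^'m" and \<alpha> \<alpha>t :: "nat \<Rightarrow> real^'p"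
    and T :: nat
  assumes pos: "\<gamma> > 0" "\<mu> > 0" "\<rho> > 0"
    and phi: "convex_on UNIV \<phi>" "smooth_wrt (1 / \<gamma>) \<phi>"
    and g_proper: "\<And>x. g x \<noteq> -\<infinity>" "\<exists>x. g x \<noteq> \<infinity>"
    and g: "ereal_convex g" "strongly_convex \<mu> g"
    and psd: "sym_psd G" "sym_psd H" "sym_psd Ht"
    and H_eq: "H = transpose A ** Ht ** A"
    and s: "0 \<le> s" "s < 1"
    and theta_pos: "\<theta> > 0"
    and theta_le: "ereal \<theta> \<le>
      min (ext_frac (\<gamma> * \<rho> * (sigma_min A)\<^sup>2) (\<gamma> * largest_eigenvalue H + 1))
        (min (ext_frac (s * \<rho>) (largest_eigenvalue Ht))
          (ext_frac ((1 - s) * \<mu>)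
            ((\<rho> + largest_eigenvalue Ht) * (largest_singular_value B)\<^sup>2
              + (1 - s) * \<rho> * largest_singular_value G)))"
    and optimal: "optimal_triple \<phi> g A B c w\<^sub>s v\<^sub>s \<alpha>\<^sub>s"
    and iterates: "padmm \<phi> g A B c \<rho> G H w v \<alpha>"
    and alpha_tilde: "\<And>t. t \<ge> 1 \<Longrightarrow> \<alpha>t t = \<alpha> t + Ht *v (A *v (w t - w (t - 1)))"
    and T: "T \<ge> 1"
  shows
    "(\<Sum>t=1..T. ereal ((1 + \<theta>) powi (int t - int T)) *
        (max (bregman (\<lambda>u. ereal (\<phi> u)) (gradient \<phi> w\<^sub>s) w\<^sub>s (w t))
             (bregman (convex_conjugate (\<lambda>u. ereal (\<phi> u))) w\<^sub>s
                (- (transpose A *v \<alpha>\<^sub>s)) (- (transpose A *v \<alpha>t t)))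
         + bregman g (transpose B *v \<alpha>\<^sub>s) v\<^sub>s (v t)))
     + ereal (\<rho> / 2 * (norm (A *v (w T - w\<^sub>s)))\<^sup>2
              + 1 / 2 * sqnorm Ht (A *v (w T - w\<^sub>s))
              + (1 + \<theta>) / (2 * \<rho>) * (norm (\<alpha> T - \<alpha>\<^sub>s))\<^sup>2
              + \<rho> * (1 + \<theta>) / 2 * sqnorm G (v T - v\<^sub>s))
     \<le> ereal ((1 + \<theta>) powi (- int T) / 2 *
          (\<rho> * (norm (A *v (w 0 - w\<^sub>s)))\<^sup>2
           + sqnorm Ht (A *v (w 0 - w\<^sub>s))
           + (1 + \<theta>) / \<rho> * (norm (\<alpha> 0 - \<alpha>\<^sub>s))\<^sup>2
           + \<rho> * (1 + \<theta>) * sqnorm G (v 0 - v\<^sub>s)))"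
proof -
  have H: "sym_psd H" "transpose H = H" and G: "transpose G = G"
    using psd by (auto simp: sym_psd_def)
  have nonneg: "0 \<le> largest_eigenvalue H" "0 \<le> largest_eigenvalue Ht"
    "0 \<le> largest_singular_value G"
    using psd by (auto intro: largest_eigenvalue_nonneg largest_singular_value_bound)
  have \<theta>1: "\<theta> * (\<gamma> * largest_eigenvalue H + 1) \<le> \<gamma> * \<rho> * (sigma_min A)\<^sup>2"
    by (rule ext_frac_bound) (use theta_le pos nonneg in auto)
  have \<theta>2: "\<theta> * largest_eigenvalue Ht \<le> s * \<rho>"
    by (rule ext_frac_bound) (use theta_le pos nonneg s in auto)
  have \<theta>3: "\<theta> * ((\<rho> + largest_eigenvalue Ht) * (largest_singular_value B)\<^sup>2
        + (1 - s) * \<rho> * largest_singular_value G) \<le> (1 - s) * \<mu>"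
    by (rule ext_frac_bound) (use theta_le pos nonneg s in auto)
  have opt: "A *v w\<^sub>s - B *v v\<^sub>s = c" "transpose A *v \<alpha>\<^sub>s = - gradient \<phi> w\<^sub>s"
    "subgradient g v\<^sub>s (transpose B *v \<alpha>\<^sub>s)"
    using optimal by (auto simp: optimal_triple_def simp del: transpose_matrix_vector)
  define E where "E t = energy \<rho> \<theta> Ht G (A *v (w t - w\<^sub>s)) (\<alpha> t - \<alpha>\<^sub>s) (v t - v\<^sub>s) / 2" for t
  let ?D = "\<lambda>t. max (bregman (\<lambda>u. ereal (\<phi> u)) (gradient \<phi> w\<^sub>s) w\<^sub>s (w t))
             (bregman (convex_conjugate (\<lambda>u. ereal (\<phi> u))) w\<^sub>s
                (- (transpose A *v \<alpha>\<^sub>s)) (- (transpose A *v \<alpha>t t)))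
         + bregman g (transpose B *v \<alpha>\<^sub>s) v\<^sub>s (v t)"
  \<comment> \<open>All divergences along the iterates are finite, so the recursion can be run over
    the reals.\<close>
  have "\<exists>D. ?D t = ereal D \<and> D + E t \<le> E (t - 1) / (1 + \<theta>)" if t: "t \<ge> 1" for t
  proof -
    define e e0 x x0 d d0 where "e = \<alpha> t - \<alpha>\<^sub>s" and "e0 = \<alpha> (t - 1) - \<alpha>\<^sub>s"
      and "x = w t - w\<^sub>s" and "x0 = w (t - 1) - w\<^sub>s"
      and "d = v t - v\<^sub>s" and "d0 = v (t - 1) - v\<^sub>s"
    define p where "p = transpose A *v (e + Ht *v (A *v (x - x0)))"
    define r where "r = transpose B *v (e0 + \<rho> *\<^sub>R (A *v x0 - B *v d)) - \<rho> *\<^sub>R (G *v (d - d0))"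
    define \<xi> where "\<xi> = transpose B *v (\<alpha> (t - 1) + \<rho> *\<^sub>R (A *v w (t - 1) - B *v v t - c))
      - \<rho> *\<^sub>R (G *v (v t - v (t - 1)))"
    have Ad: "A *v x - B *v d = A *v w t - B *v v t - c"
      "A *v x0 - B *v d = A *v w (t - 1) - B *v v t - c"
      by (simp_all add: x_def x0_def d_def matrix_vector_mult_diff_distrib opt(1)[symmetric])
    have e: "e = e0 + \<rho> *\<^sub>R (A *v x - B *v d)"
      using iterates t unfolding padmm_def e_def e0_def Ad by auto
    note grad = smooth_wrtD(1)[OF phi(2)]
    \<comment> \<open>The factorization of \<open>H\<close> turns the proximal term into the
      correction that defines \<open>\<alpha>t t\<close>.\<close>
    have at: "- (transpose A *v \<alpha>t t) = gradient \<phi> (w t)"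
      using padmm_w_step[OF iterates t H(2) phi(1) grad]
      by (simp add: alpha_tilde[OF t] H_eq matrix_vector_mul_assoc[symmetric]
          matrix_vector_right_distrib del: transpose_matrix_vector)
    have p: "gradient \<phi> (w t) - gradient \<phi> w\<^sub>s = - p"
      using opt(2)
      by (simp add: at[symmetric] alpha_tilde[OF t] p_def e_def x_def x0_def
          matrix_vector_right_distrib matrix_vector_mult_diff_distrib del: transpose_matrix_vector)
    have r: "r = \<xi> - transpose B *v \<alpha>\<^sub>s"
    proof -
      have "d - d0 = v t - v (t - 1)" "e0 + y = \<alpha> (t - 1) + y - \<alpha>\<^sub>s" for y
        by (simp_all add: d_def d0_def e0_def)
      then show ?thesis
        unfolding r_def \<xi>_def Ad by (simp only: matrix_vector_mult_diff_distrib[of "transpose B"]) simp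
    qed
    have \<xi>: "subgradient g (v t) \<xi>"
      unfolding \<xi>_def by (rule padmm_v_step[OF iterates t G g_proper g(1)])
    obtain gt gs where gt: "g (v t) = ereal gt" and gs: "g v\<^sub>s = ereal gs"
      using \<xi> opt(3) by (auto simp: subgradient_def)
    \<comment> \<open>Strong convexity is used at \<open>v t\<close> towards the optimum, the
      reverse of the divergence to be bounded.\<close>
    have strong: "\<mu> / 2 * (norm d)\<^sup>2 \<le> gs - gt + \<xi> \<bullet> d"
      using g(2)[unfolded strongly_convex_def, rule_format, OF \<xi>, of v\<^sub>s]
      by (simp add: bregman_def gt gs d_def inner_diff_right)
    define D1 D2 D3 where "D1 = \<phi> (w t) - \<phi> w\<^sub>s - gradient \<phi> w\<^sub>s \<bullet> x"
      and "D2 = \<phi> w\<^sub>s - \<phi> (w t) + gradient \<phi> (w t) \<bullet> x"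
      and "D3 = gt - gs - (transpose B *v \<alpha>\<^sub>s) \<bullet> d"
    have B1: "bregman (\<lambda>u. ereal (\<phi> u)) (gradient \<phi> w\<^sub>s) w\<^sub>s (w t) = ereal D1"
      by (simp add: bregman_ereal D1_def x_def)
    have as: "- (transpose A *v \<alpha>\<^sub>s) = gradient \<phi> w\<^sub>s" using opt(2) by simp
    have B2: "bregman (convex_conjugate (\<lambda>u. ereal (\<phi> u))) w\<^sub>s
        (- (transpose A *v \<alpha>\<^sub>s)) (- (transpose A *v \<alpha>t t)) = ereal D2"
      unfolding at as bregman_convex_conjugate[OF phi(1) grad grad]
      by (simp add: bregman_ereal D2_def x_def inner_diff_right)
    have B3: "bregman g (transpose B *v \<alpha>\<^sub>s) v\<^sub>s (v t) = ereal D3"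
      by (simp add: bregman_def D3_def gt gs d_def del: transpose_matrix_vector)
    have "D1 + D2 = - (p \<bullet> x)"
      using p by (simp add: D1_def D2_def inner_diff_left[symmetric])
    moreover have "\<gamma> / 2 * (norm p)\<^sup>2 \<le> D1"
      using bregman_ge_gradient_diff[OF phi pos(1), of "w t" "w\<^sub>s"] by (simp add: p D1_def x_def)
    moreover have "\<gamma> / 2 * (norm p)\<^sup>2 \<le> D2"
    proof -
      have "gradient \<phi> w\<^sub>s - gradient \<phi> (w t) = p" using p by (simp add: algebra_simps)
      then show ?thesis
        using bregman_ge_gradient_diff[OF phi pos(1), of "w\<^sub>s" "w t"]
        by (simp add: D2_def x_def inner_diff_right)
    qed
    moreover have "D3 \<le> r \<bullet> d - \<mu> / 2 * (norm d)\<^sup>2"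
      using strong by (simp add: r D3_def inner_diff_left del: transpose_matrix_vector)
    \<comment> \<open>The maximum is the sum \<open>- (p \<bullet> x)\<close> minus the smaller
      divergence, and both divergences are at least
      \<open>\<gamma> / 2 * (norm p)\<^sup>2\<close>.\<close>
    ultimately have "max D1 D2 + D3 \<le> - (p \<bullet> x) - \<gamma> / 2 * (norm p)\<^sup>2 + r \<bullet> d - \<mu> / 2 * (norm d)\<^sup>2"
      by linarith
    moreover have "- (p \<bullet> x) - \<gamma> / 2 * (norm p)\<^sup>2 + r \<bullet> d - \<mu> / 2 * (norm d)\<^sup>2 + E t
        \<le> E (t - 1) / (1 + \<theta>)"
      using energy_contraction[OF psd H_eq pos(1,3) theta_pos s \<theta>1 \<theta>2 \<theta>3 e p_def r_def]
      by (simp add: E_def e_def e0_def x_def x0_def d_def d0_def)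
    ultimately have "max D1 D2 + D3 + E t \<le> E (t - 1) / (1 + \<theta>)" by linarith
    then show ?thesis
      unfolding B1 B2 B3 by (intro exI[of _ "max D1 D2 + D3"]) (simp add: max_def)
  qed
  then have "\<forall>t. \<exists>D. t \<ge> 1 \<longrightarrow> ?D t = ereal D \<and> D + E t \<le> E (t - 1) / (1 + \<theta>)" by blast
  from choice[OF this] obtain D
    where D: "\<And>t. t \<ge> 1 \<Longrightarrow> ?D t = ereal (D t)"
      and le: "\<And>t. t \<ge> 1 \<Longrightarrow> D t + E t \<le> E (t - 1) / (1 + \<theta>)"
    by blast
  have sum: "(\<Sum>t=1..T. ereal ((1 + \<theta>) powi (int t - int T)) * ?D t)
    = ereal (\<Sum>t=1..T. (1 + \<theta>) powi (int t - int T) * D t)"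
    unfolding sum_ereal[symmetric]
  proof (rule sum.cong[OF refl])
    fix t assume "t \<in> {1..T}"
    then have "t \<ge> 1" by simp
    from D[OF this] show "ereal ((1 + \<theta>) powi (int t - int T)) * ?D t
      = ereal ((1 + \<theta>) powi (int t - int T) * D t)"
      by (simp only: times_ereal.simps)
  qed
  have ET: "E T = \<rho> / 2 * (norm (A *v (w T - w\<^sub>s)))\<^sup>2
              + 1 / 2 * sqnorm Ht (A *v (w T - w\<^sub>s))
              + (1 + \<theta>) / (2 * \<rho>) * (norm (\<alpha> T - \<alpha>\<^sub>s))\<^sup>2
              + \<rho> * (1 + \<theta>) / 2 * sqnorm G (v T - v\<^sub>s)"
    by (simp add: E_def energy_def add_divide_distrib)
  have E0: "(1 + \<theta>) powi (- int T) * E 0 = (1 + \<theta>) powi (- int T) / 2 *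
          (\<rho> * (norm (A *v (w 0 - w\<^sub>s)))\<^sup>2
           + sqnorm Ht (A *v (w 0 - w\<^sub>s))
           + (1 + \<theta>) / \<rho> * (norm (\<alpha> 0 - \<alpha>\<^sub>s))\<^sup>2
           + \<rho> * (1 + \<theta>) * sqnorm G (v 0 - v\<^sub>s))"
    by (simp add: E_def energy_def)
  have "(\<Sum>t=1..T. (1 + \<theta>) powi (int t - int T) * D t) + E T \<le> (1 + \<theta>) powi (- int T) * E 0"
    using theta_pos le by (intro geometric_telescope) auto
  then show ?thesis
    unfolding sum ET[symmetric] E0[symmetric] by (simp only: plus_ereal.simps ereal_less_eq)
qed

end
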